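(* Let $f:\mathbb{R}^n\to\mathbb{R}$ be twice continuously differentiable with $\sup_{x\in\mathbb{R}^n}\|\nabla^2 f(x)\|_2\le L<\infty$, let $\varphi_t:\mathbb{R}^{n_t}\to\mathbb{R}$ ($t=1,\dots,p$) be twice continuously differentiable and $\mu_t$-strongly convex with $\mu_t>0$, and let $\mu=\min_t\mu_t$. Then the set of initial points $x_0\in\mathbb{R}^n$ for which the BMD method with step size $0<\alpha<\frac{\mu}{L}$ converges to a strict saddle point of $f$ has Lebesgue measure zero (no assumption that the critical points of $f$ are isolated is made).
   Context: The variable is partitioned as $x=(x(1),\dots,x(p))$, $x(t)\in\mathbb{R}^{n_t}$, $\sum_tn_t=n$; $\nabla_t f(x)$ is the gradient of $f$ with respect to the block $x(t)$. Strong convexity: $\varphi_t(y)\ge\varphi_t(x)+\langle\nabla\varphi_t(x),y-x\rangle+\frac{\mu_t}{2}\|y-x\|^2$. Bregman divergence: $B_{\varphi_t}(u,v)=\varphi_t(u)-\varphi_t(v)-\langle u-v,\nabla\varphi_t(v)\rangle$. BMD method: given $x_k$, set $x_k^0=x_k$ and for $s=1,\dots,p$ let $x_k^s(s)=\arg\min_{u}\langle u,\nabla_s f(x_k^{s-1})\rangle+\frac1\alpha B_{\varphi_s}(u,x_k^{s-1}(s))$ and $x_k^s(t)=x_k^{s-1}(t)$ for $t\ne s$; then $x_{k+1}=x_k^p$. A strict saddle point is a point $x^*$ with $\nabla f(x^* )=0$ and $\lambda_{\min}(\nabla^2f(x^* ))<0$. *)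

theory Defs
  imports "HOL-Analysis.Analysis"
begin

text \<open>Block structure: the coordinates of real^'n are partitioned into index sets
  I 0, ..., I (p-1).  A block vector u in R^(n_t) is identified with the vector of
  real^'n which agrees with the current point off the block I t.\<close>

definition block_partition :: "nat \<Rightarrow> (nat \<Rightarrow> 'n set) \<Rightarrow> bool" where
  "block_partition p I \<longleftrightarrow> p \<ge> 1 \<and> (\<forall>t<p. I t \<noteq> {}) \<and>
     (\<forall>s<p. \<forall>t<p. s \<noteq> t \<longrightarrow> I s \<inter> I t = {}) \<and> (\<Union>t<p. I t) = UNIV"

definition same_off :: "'n set \<Rightarrow> real^'n \<Rightarrow> real^'n \<Rightarrow> bool" where
  "same_off J x y \<longleftrightarrow> (\<forall>i. i \<notin> J \<longrightarrow> y $ i = x $ i)"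

definition bregman :: "(real^'n \<Rightarrow> real) \<Rightarrow> (real^'n \<Rightarrow> real^'n) \<Rightarrow> real^'n \<Rightarrow> real^'n \<Rightarrow> real" where
  "bregman \<phi> \<phi>' u v = \<phi> u - \<phi> v - (u - v) \<bullet> \<phi>' v"

definition block_obj where
  "block_obj J f' \<phi> \<phi>' \<alpha> x u =
     (\<Sum>i\<in>J. u $ i * f' x $ i) + (1 / \<alpha>) * bregman \<phi> \<phi>' u x"

definition block_update ::
  "'n set \<Rightarrow> (real^'n \<Rightarrow> real^'n) \<Rightarrow> (real^'n \<Rightarrow> real) \<Rightarrow> (real^'n \<Rightarrow> real^'n)
    \<Rightarrow> real \<Rightarrow> real^'n \<Rightarrow> real^'n" where
  "block_update J f' \<phi> \<phi>' \<alpha> x =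
     (SOME y. same_off J x y \<and>
        (\<forall>z. same_off J x z \<longrightarrow> block_obj J f' \<phi> \<phi>' \<alpha> x y \<le> block_obj J f' \<phi> \<phi>' \<alpha> x z))"

fun bmd_inner ::
  "(nat \<Rightarrow> 'n set) \<Rightarrow> (real^'n \<Rightarrow> real^'n) \<Rightarrow> (nat \<Rightarrow> real^'n \<Rightarrow> real)
    \<Rightarrow> (nat \<Rightarrow> real^'n \<Rightarrow> real^'n) \<Rightarrow> real \<Rightarrow> real^'n \<Rightarrow> nat \<Rightarrow> real^'n" where
  "bmd_inner I f' \<phi> \<phi>' \<alpha> x 0 = x"
| "bmd_inner I f' \<phi> \<phi>' \<alpha> x (Suc s) =
     block_update (I s) f' (\<phi> s) (\<phi>' s) \<alpha> (bmd_inner I f' \<phi> \<phi>' \<alpha> x s)"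

definition bmd_step where
  "bmd_step p I f' \<phi> \<phi>' \<alpha> x = bmd_inner I f' \<phi> \<phi>' \<alpha> x p"

definition bmd_seq where
  "bmd_seq p I f' \<phi> \<phi>' \<alpha> x0 k = (bmd_step p I f' \<phi> \<phi>' \<alpha> ^^ k) x0"

definition real_eigenvalues :: "real^'n^'n \<Rightarrow> real set" where
  "real_eigenvalues A = {c. \<exists>v. v \<noteq> 0 \<and> A *v v = c *\<^sub>R v}"

definition lambda_min :: "real^'n^'n \<Rightarrow> real" where
  "lambda_min A = Min (real_eigenvalues A)"

definition strict_saddle :: "(real^'n \<Rightarrow> real^'n) \<Rightarrow> (real^'n \<Rightarrow> real^'n^'n) \<Rightarrow> real^'n \<Rightarrow> bool" where
  "strict_saddle f' f'' x \<longleftrightarrow> f' x = 0 \<and> lambda_min (f'' x) < 0"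

end

theory Submission
  imports Defs
begin

text \<open>Let \<open>A\<close> be the linearization of the sweep \<open>g\<close> at a strict saddle point and \<open>H\<close> the Hessian of
  \<open>f\<close> there. Each block update lowers \<open>v \<bullet> H v\<close> by a multiple of the squared displacement, so
  \<open>A v \<bullet> H (A v) \<le> v \<bullet> H v - c * (norm (A v - v))\<^sup>2\<close>, and \<open>A v = v\<close> exactly when \<open>H v = 0\<close>. Hence for
  small \<open>\<eta> > 0\<close> the form \<open>P v = - (v \<bullet> H v) - \<eta> * (norm v)\<^sup>2\<close> strictly increases along \<open>A\<close> on the cone
  \<open>P \<ge> 0\<close>, robustly under small perturbations of \<open>A\<close>. Consequently two orbits that stay close to the
  saddle forever start at points with \<open>P (x - y) \<le> 0\<close>, i.e. the trapped points lie on a Lipschitz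
  graph over a hyperplane and form a null set. This replaces the center-stable manifold theorem
  and needs no spectral splitting. By Lindelof countably many such neighbourhoods cover all strict
  saddles, and preimages of null sets under \<open>g\<close> are null because each block update is
  \<open>Psi\<^sub>0\<inverse> \<circ> Psi\<^sub>\<alpha>\<close> with \<open>Psi\<^sub>0\<close> differentiable and \<open>Psi\<^sub>\<alpha>\<close> having a Lipschitz inverse; this is where
  \<open>\<alpha> * L < \<mu>\<close> enters.\<close>

section \<open>Null sets\<close>

text \<open>The bound makes \<open>F\<close> injective on \<open>S\<close> with a
  \<open>C\<close>-Lipschitz inverse on the image, and Lipschitz maps send null sets to null
  sets.\<close>

lemma negligible_of_negligible_expanding_image:
  fixes F :: "'a::euclidean_space \<Rightarrow> 'a"
  assumes neg: "negligible (F ` S)"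
    and exp: "\<And>x y. x \<in> S \<Longrightarrow> y \<in> S \<Longrightarrow> norm (x - y) \<le> C * norm (F x - F y)"
  shows "negligible S"
proof -
  have inj: "inj_on F S"
    using exp by (force simp: inj_on_def)
  have "negligible (the_inv_into S F ` (F ` S))"
  proof (rule negligible_locally_Lipschitz_image[OF order_refl neg])
    fix u assume "u \<in> F ` S"
    then show "\<exists>T B. open T \<and> u \<in> T \<and> (\<forall>w \<in> F ` S \<inter> T.
        norm (the_inv_into S F w - the_inv_into S F u) \<le> B * norm (w - u))"
      by (intro exI[of _ UNIV] exI[of _ C]) (auto simp: the_inv_into_f_f[OF inj] exp)
  qed
  then show ?thesis
    by (simp add: the_inv_into_onto[OF inj])
qed

text \<open>Differences of points of \<open>S\<close> stay out of an open cone around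
  \<open>e\<close>, so the projection along \<open>e\<close> onto the hyperplane orthogonal to
  \<open>e\<close> shrinks distances by at most a constant factor: \<open>S\<close> is a Lipschitz
  graph over a subset of that hyperplane.\<close>

lemma negligible_avoiding_quadratic_cone:
  fixes B :: "'a::euclidean_space \<Rightarrow> 'a"
  assumes lin: "linear B" and e: "e \<bullet> B e > 0"
    and avoid: "\<And>x y. x \<in> S \<Longrightarrow> y \<in> S \<Longrightarrow> (x - y) \<bullet> B (x - y) \<le> 0"
  shows "negligible S"
proof -
  have e0: "e \<noteq> 0" using e by auto
  obtain b where b: "b > 0" "\<And>x. norm (B x) \<le> b * norm x"
    using linear_bounded_pos[OF lin] by blast
  define F where "F x = x - ((x \<bullet> e) / (e \<bullet> e)) *\<^sub>R e" for x
  have linF: "F (x - y) = F x - F y" for x y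
    by (simp add: F_def inner_diff_left diff_divide_distrib algebra_simps)
  define p0 where "p0 = e \<bullet> B e"
  have p0: "p0 > 0" using e by (simp add: p0_def)
  \<comment> \<open>If \<open>s\<close> violated the bound, the summand \<open>1\<close> would give
    \<open>norm w \<le> \<bar>s\<bar> * norm e\<close>, so the three terms of the form containing
    \<open>w\<close> would total at most \<open>3 * b * \<bar>s\<bar> * norm e * norm w\<close>; the
    other summand of \<open>K\<close> makes this smaller than \<open>s\<^sup>2 * p0\<close>, and the
    form would be positive.\<close>
  define K where "K = 3 * b * norm e * norm e / p0 + 1"
  have key: "\<bar>s\<bar> * norm e \<le> K * norm w" if neg: "(s *\<^sub>R e + w) \<bullet> B (s *\<^sub>R e + w) \<le> 0" for s w
  proof (rule ccontr)
    assume "\<not> \<bar>s\<bar> * norm e \<le> K * norm w"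
    then have big: "K * norm w < \<bar>s\<bar> * norm e" by simp
    have "(s *\<^sub>R e + w) \<bullet> B (s *\<^sub>R e + w) = s\<^sup>2 * p0 + s * (e \<bullet> B w + w \<bullet> B e) + w \<bullet> B w"
      by (simp add: linear_add[OF lin] linear_scale[OF lin] inner_add_left inner_add_right p0_def
          algebra_simps power2_eq_square)
    moreover have ew: "\<bar>e \<bullet> B w\<bar> \<le> b * norm e * norm w" "\<bar>w \<bullet> B e\<bar> \<le> b * norm e * norm w"
      "\<bar>w \<bullet> B w\<bar> \<le> b * norm w * norm w"
      using Cauchy_Schwarz_ineq2[of e "B w"] Cauchy_Schwarz_ineq2[of w "B e"] Cauchy_Schwarz_ineq2[of w "B w"]
        mult_left_mono[OF b(2)[of w] norm_ge_zero[of e]] mult_left_mono[OF b(2)[of e] norm_ge_zero[of w]]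
        mult_left_mono[OF b(2)[of w] norm_ge_zero[of w]]
      by (auto simp: mult_ac)
    moreover have "\<bar>s * (e \<bullet> B w + w \<bullet> B e)\<bar> \<le> \<bar>s\<bar> * (2 * (b * norm e * norm w))"
      unfolding abs_mult using ew by (intro mult_left_mono) auto
    ultimately have 1: "s\<^sup>2 * p0 \<le> \<bar>s\<bar> * (2 * (b * norm e * norm w)) + b * norm w * norm w"
      using neg by linarith
    have ne: "norm e > 0" using e0 by simp
    have K1: "K * norm w = 3 * b * norm e * norm e / p0 * norm w + norm w"
      by (simp add: K_def algebra_simps)
    have nn: "0 \<le> 3 * b * norm e * norm e / p0 * norm w" using b(1) p0 by simp
    have "norm w \<le> \<bar>s\<bar> * norm e"
      using big K1 nn by linarith
    then have 2: "b * norm w * norm w \<le> b * norm w * (\<bar>s\<bar> * norm e)"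
      using b by (intro mult_left_mono) auto
    have "3 * b * norm e * norm e / p0 * norm w < \<bar>s\<bar> * norm e"
      using big K1 norm_ge_zero[of w] by linarith
    then have "(3 * b * norm e / p0 * norm w) * norm e < \<bar>s\<bar> * norm e" by (simp add: mult_ac)
    then have "3 * b * norm e / p0 * norm w < \<bar>s\<bar>"
      by (rule mult_right_less_imp_less) simp
    then have 3: "3 * b * norm e * norm w < \<bar>s\<bar> * p0" using p0 by (simp add: field_simps)
    have "\<bar>s\<bar> > 0"
      using \<open>3 * b * norm e / p0 * norm w < \<bar>s\<bar>\<close> b(1) p0
      by (meson divide_nonneg_pos le_less_trans less_imp_le mult_nonneg_nonneg norm_ge_zero zero_le_numeral)
    then have "\<bar>s\<bar> * (3 * b * norm e * norm w) < \<bar>s\<bar> * (\<bar>s\<bar> * p0)"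
      using 3 by simp
    also have "\<dots> = s\<^sup>2 * p0" by (simp add: power2_eq_square)
    finally show False using 1 2 by (simp add: algebra_simps)
  qed
  have exp: "norm (x - y) \<le> (K + 1) * norm (F x - F y)" if "x \<in> S" "y \<in> S" for x y
  proof -
    define s where "s = ((x - y) \<bullet> e) / (e \<bullet> e)"
    have dec: "x - y = s *\<^sub>R e + F (x - y)" by (simp add: F_def s_def)
    have "\<bar>s\<bar> * norm e \<le> K * norm (F (x - y))"
      using avoid[OF that] dec key by metis
    moreover have "norm (x - y) \<le> \<bar>s\<bar> * norm e + norm (F (x - y))"
      using norm_triangle_ineq[of "s *\<^sub>R e" "F (x - y)"] dec by simp
    ultimately show ?thesis by (simp add: linF algebra_simps)
  qed
  have "negligible {x. e \<bullet> x = 0}"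
    using e0 by (intro negligible_hyperplane) auto
  moreover have "F ` S \<subseteq> {x. e \<bullet> x = 0}"
    using e0 by (auto simp: F_def inner_diff_right inner_commute)
  ultimately have "negligible (F ` S)" by (rule negligible_subset)
  then show ?thesis using exp by (rule negligible_of_negligible_expanding_image)
qed

section \<open>Strict (two-point) derivatives\<close>

text \<open>The strong Frechet derivative. Both points vary because the instability argument
  compares two arbitrary orbits near \<open>a\<close>, not one orbit with the fixed point.\<close>

definition has_strict_derivative ::
  "('a::real_normed_vector \<Rightarrow> 'b::real_normed_vector) \<Rightarrow> ('a \<Rightarrow> 'b) \<Rightarrow> 'a \<Rightarrow> bool" where
  "has_strict_derivative g A a \<longleftrightarrow> linear A \<and>
     (\<forall>\<epsilon>>0. \<exists>\<delta>>0. \<forall>x\<in>ball a \<delta>. \<forall>y\<in>ball a \<delta>. norm (g x - g y - A (x - y)) \<le> \<epsilon> * norm (x - y))"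

lemma has_strict_derivativeD:
  assumes "has_strict_derivative g A a" "\<epsilon> > 0"
  obtains \<delta> where "\<delta> > 0"
    "\<And>x y. x \<in> ball a \<delta> \<Longrightarrow> y \<in> ball a \<delta> \<Longrightarrow> norm (g x - g y - A (x - y)) \<le> \<epsilon> * norm (x - y)"
  using assms unfolding has_strict_derivative_def by metis

lemma has_strict_derivative_imp_locally_Lipschitz:
  fixes A :: "'a::euclidean_space \<Rightarrow> 'b::real_normed_vector"
  assumes "has_strict_derivative g A a"
  obtains \<delta> K where "\<delta> > 0" "K > 0"
    "\<And>x y. x \<in> ball a \<delta> \<Longrightarrow> y \<in> ball a \<delta> \<Longrightarrow> norm (g x - g y) \<le> K * norm (x - y)"
proof -
  have "linear A" using assms by (simp add: has_strict_derivative_def)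
  then obtain k where k: "k > 0" "\<And>x. norm (A x) \<le> k * norm x"
    using linear_bounded_pos by blast
  obtain \<delta> where d: "\<delta> > 0"
    "\<And>x y. x \<in> ball a \<delta> \<Longrightarrow> y \<in> ball a \<delta> \<Longrightarrow> norm (g x - g y - A (x - y)) \<le> 1 * norm (x - y)"
    using has_strict_derivativeD[OF assms zero_less_one] by metis
  show ?thesis
  proof (rule that[of \<delta> "k + 1"])
    fix x y assume "x \<in> ball a \<delta>" "y \<in> ball a \<delta>"
    from d(2)[OF this] k(2)[of "x - y"] norm_triangle_ineq[of "g x - g y - A (x - y)" "A (x - y)"]
    show "norm (g x - g y) \<le> (k + 1) * norm (x - y)" by (simp add: algebra_simps)
  qed (use d k in auto)
qed

section \<open>Calculus rules for strict derivatives\<close>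

lemma has_strict_derivative_id: "has_strict_derivative (\<lambda>x. x) (\<lambda>x. x) a"
  unfolding has_strict_derivative_def by (auto simp: linear_ident intro: zero_less_one)

lemma has_strict_derivative_linear: "linear A \<Longrightarrow> has_strict_derivative A A a"
  unfolding has_strict_derivative_def by (auto simp: linear_diff intro: zero_less_one)

lemma has_strict_derivative_add:
  assumes "has_strict_derivative g A a" "has_strict_derivative h B a"
  shows "has_strict_derivative (\<lambda>x. g x + h x) (\<lambda>x. A x + B x) a"
  unfolding has_strict_derivative_def
proof (intro conjI allI impI)
  show "linear (\<lambda>x. A x + B x)"
    using assms by (simp add: has_strict_derivative_def linear_compose_add)
  fix \<epsilon> :: real assume "\<epsilon> > 0"
  then have e: "\<epsilon> / 2 > 0" by simp
  obtain d1 where d1: "d1 > 0" "\<And>x y. x \<in> ball a d1 \<Longrightarrow> y \<in> ball a d1 \<Longrightarrow>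
      norm (g x - g y - A (x - y)) \<le> \<epsilon> / 2 * norm (x - y)"
    using has_strict_derivativeD[OF assms(1) e] by metis
  obtain d2 where d2: "d2 > 0" "\<And>x y. x \<in> ball a d2 \<Longrightarrow> y \<in> ball a d2 \<Longrightarrow>
      norm (h x - h y - B (x - y)) \<le> \<epsilon> / 2 * norm (x - y)"
    using has_strict_derivativeD[OF assms(2) e] by metis
  show "\<exists>\<delta>>0. \<forall>x\<in>ball a \<delta>. \<forall>y\<in>ball a \<delta>.
      norm (g x + h x - (g y + h y) - (A (x - y) + B (x - y))) \<le> \<epsilon> * norm (x - y)"
  proof (intro exI[of _ "min d1 d2"] conjI ballI)
    fix x y assume "x \<in> ball a (min d1 d2)" "y \<in> ball a (min d1 d2)"
    then have "norm (g x - g y - A (x - y)) \<le> \<epsilon> / 2 * norm (x - y)"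
      "norm (h x - h y - B (x - y)) \<le> \<epsilon> / 2 * norm (x - y)"
      using d1(2) d2(2) by auto
    then show "norm (g x + h x - (g y + h y) - (A (x - y) + B (x - y))) \<le> \<epsilon> * norm (x - y)"
      using norm_triangle_ineq[of "g x - g y - A (x - y)" "h x - h y - B (x - y)"]
      by (simp add: algebra_simps)
  qed (use d1 d2 in auto)
qed

lemma has_strict_derivative_compose:
  fixes A :: "'a::euclidean_space \<Rightarrow> 'b::euclidean_space" and B :: "'b \<Rightarrow> 'c::real_normed_vector"
  assumes g: "has_strict_derivative g A a" and h: "has_strict_derivative h B (g a)"
  shows "has_strict_derivative (\<lambda>x. h (g x)) (\<lambda>x. B (A x)) a"
  unfolding has_strict_derivative_def
proof (intro conjI allI impI)
  have lin: "linear A" "linear B" using g h by (auto simp: has_strict_derivative_def)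
  then show "linear (\<lambda>x. B (A x))" using linear_compose[of A B] by (simp add: o_def)
  fix \<epsilon> :: real assume e: "\<epsilon> > 0"
  obtain d0 K where K: "d0 > 0" "K > 0" "\<And>x y. x \<in> ball a d0 \<Longrightarrow> y \<in> ball a d0 \<Longrightarrow>
      norm (g x - g y) \<le> K * norm (x - y)"
    using has_strict_derivative_imp_locally_Lipschitz[OF g] by metis
  obtain b where b: "b > 0" "\<And>x. norm (B x) \<le> b * norm x"
    using linear_bounded_pos[OF lin(2)] by blast
  have "\<epsilon> / (2 * b) > 0" "\<epsilon> / (2 * K) > 0" using e b K by auto
  then obtain d1 d2 where d1: "d1 > 0" "\<And>x y. x \<in> ball a d1 \<Longrightarrow> y \<in> ball a d1 \<Longrightarrow>
      norm (g x - g y - A (x - y)) \<le> \<epsilon> / (2 * b) * norm (x - y)"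
    and d2: "d2 > 0" "\<And>x y. x \<in> ball (g a) d2 \<Longrightarrow> y \<in> ball (g a) d2 \<Longrightarrow>
      norm (h x - h y - B (x - y)) \<le> \<epsilon> / (2 * K) * norm (x - y)"
    using has_strict_derivativeD[OF g] has_strict_derivativeD[OF h] by metis
  define d where "d = min d0 (min d1 (d2 / K))"
  have d: "d > 0" "d \<le> d0" "d \<le> d1" "K * d \<le> d2"
  proof -
    show "d > 0" "d \<le> d0" "d \<le> d1" using K d1 d2 by (auto simp: d_def)
    have "d \<le> d2 / K" by (simp add: d_def)
    then show "K * d \<le> d2" using K(2) by (simp add: field_simps)
  qed
  show "\<exists>\<delta>>0. \<forall>x\<in>ball a \<delta>. \<forall>y\<in>ball a \<delta>.
      norm (h (g x) - h (g y) - B (A (x - y))) \<le> \<epsilon> * norm (x - y)"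
  proof (intro exI[of _ d] conjI ballI)
    fix x y assume xy: "x \<in> ball a d" "y \<in> ball a d"
    have mem: "g z \<in> ball (g a) d2" if "z \<in> ball a d" for z
    proof -
      have "norm (g a - g z) \<le> K * norm (a - z)" using that d K by auto
      also have "\<dots> < K * d" using that K by (simp add: dist_norm)
      finally show ?thesis using d by (simp add: dist_norm)
    qed
    have "norm (h (g x) - h (g y) - B (g x - g y)) \<le> \<epsilon> / (2 * K) * norm (g x - g y)"
      using d2 mem xy by blast
    also have "\<dots> \<le> \<epsilon> / (2 * K) * (K * norm (x - y))"
      using K xy d e by (intro mult_left_mono) auto
    also have "\<dots> = \<epsilon> / 2 * norm (x - y)" using K by simp
    finally have 1: "norm (h (g x) - h (g y) - B (g x - g y)) \<le> \<epsilon> / 2 * norm (x - y)" .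
    have "norm (B (g x - g y - A (x - y))) \<le> b * norm (g x - g y - A (x - y))" by (rule b)
    also have "\<dots> \<le> b * (\<epsilon> / (2 * b) * norm (x - y))"
      using b d1 xy d by (intro mult_left_mono) auto
    also have "\<dots> = \<epsilon> / 2 * norm (x - y)" using b by simp
    finally have 2: "norm (B (g x - g y - A (x - y))) \<le> \<epsilon> / 2 * norm (x - y)" .
    have eq: "h (g x) - h (g y) - B (A (x - y)) = (h (g x) - h (g y) - B (g x - g y)) + B (g x - g y - A (x - y))"
      by (simp add: linear_diff[OF lin(2)])
    show "norm (h (g x) - h (g y) - B (A (x - y))) \<le> \<epsilon> * norm (x - y)"
      unfolding eq using 1 2 norm_triangle_ineq[of "h (g x) - h (g y) - B (g x - g y)" "B (g x - g y - A (x - y))"]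
      by linarith
  qed (use d in auto)
qed

text \<open>Expansion of \<open>F\<close> makes \<open>g\<close> Lipschitz near \<open>a\<close>, so
  the linearization error of \<open>F\<close> between \<open>g x\<close> and \<open>g y\<close> is
  small relative to \<open>norm (x - y)\<close>; \<open>Mi\<close> then solves for
  \<open>g x - g y\<close>.\<close>

lemma has_strict_derivative_implicit:
  fixes M N :: "'a::euclidean_space \<Rightarrow> 'a"
  assumes F: "has_strict_derivative F M a" and G: "has_strict_derivative G N a"
    and eq: "\<And>x. F (g x) = G x" and fixpt: "g a = a"
    and exp: "\<And>x y. norm (x - y) \<le> C * norm (F x - F y)"
    and Mi: "linear Mi" "\<And>x. Mi (M x) = x"
  shows "has_strict_derivative g (\<lambda>x. Mi (N x)) a"
  unfolding has_strict_derivative_def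
proof (intro conjI allI impI)
  have lin: "linear M" "linear N" using F G by (auto simp: has_strict_derivative_def)
  then show "linear (\<lambda>x. Mi (N x))" using linear_compose[of N Mi] Mi by (simp add: o_def)
  fix \<epsilon> :: real assume e: "\<epsilon> > 0"
  obtain d0 K where K: "d0 > 0" "K > 0" "\<And>x y. x \<in> ball a d0 \<Longrightarrow> y \<in> ball a d0 \<Longrightarrow>
      norm (G x - G y) \<le> K * norm (x - y)"
    using has_strict_derivative_imp_locally_Lipschitz[OF G] by metis
  define K' where "K' = (\<bar>C\<bar> + 1) * K"
  have K': "K' > 0" using K by (simp add: K'_def add_nonneg_pos)
  have lip: "norm (g x - g y) \<le> K' * norm (x - y)" if "x \<in> ball a d0" "y \<in> ball a d0" for x y
  proof -
    have "norm (g x - g y) \<le> C * norm (G x - G y)" using exp[of "g x" "g y"] eq by simp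
    also have "\<dots> \<le> (\<bar>C\<bar> + 1) * norm (G x - G y)" by (intro mult_right_mono) auto
    also have "\<dots> \<le> (\<bar>C\<bar> + 1) * (K * norm (x - y))" using K that by (intro mult_left_mono) auto
    finally show ?thesis by (simp add: K'_def mult_ac)
  qed
  obtain b where b: "b > 0" "\<And>x. norm (Mi x) \<le> b * norm x"
    using linear_bounded_pos[OF Mi(1)] by blast
  have "\<epsilon> / (2 * b) > 0" "\<epsilon> / (2 * b * K') > 0" using e b K' by auto
  then obtain d1 d2 where d1: "d1 > 0" "\<And>x y. x \<in> ball a d1 \<Longrightarrow> y \<in> ball a d1 \<Longrightarrow>
      norm (G x - G y - N (x - y)) \<le> \<epsilon> / (2 * b) * norm (x - y)"
    and d2: "d2 > 0" "\<And>x y. x \<in> ball a d2 \<Longrightarrow> y \<in> ball a d2 \<Longrightarrow>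
      norm (F x - F y - M (x - y)) \<le> \<epsilon> / (2 * b * K') * norm (x - y)"
    using has_strict_derivativeD[OF F] has_strict_derivativeD[OF G] by metis
  define d where "d = min d0 (min d1 (d2 / K'))"
  have d: "d > 0" "d \<le> d0" "d \<le> d1" "K' * d \<le> d2"
  proof -
    show "d > 0" "d \<le> d0" "d \<le> d1" using K K' d1 d2 by (auto simp: d_def)
    have "d \<le> d2 / K'" by (simp add: d_def)
    then show "K' * d \<le> d2" using K' by (simp add: field_simps)
  qed
  show "\<exists>\<delta>>0. \<forall>x\<in>ball a \<delta>. \<forall>y\<in>ball a \<delta>.
      norm (g x - g y - Mi (N (x - y))) \<le> \<epsilon> * norm (x - y)"
  proof (intro exI[of _ d] conjI ballI)
    fix x y assume xy: "x \<in> ball a d" "y \<in> ball a d"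
    have mem: "g z \<in> ball a d2" if "z \<in> ball a d" for z
    proof -
      have "norm (g a - g z) \<le> K' * norm (a - z)" using that d K by (auto intro!: lip)
      also have "\<dots> < K' * d" using that K' by (simp add: dist_norm)
      finally show ?thesis using d fixpt by (simp add: dist_norm)
    qed
    have "norm (F (g x) - F (g y) - M (g x - g y)) \<le> \<epsilon> / (2 * b * K') * norm (g x - g y)"
      using d2 mem xy by blast
    also have "\<dots> \<le> \<epsilon> / (2 * b * K') * (K' * norm (x - y))"
      using K' b xy d e by (intro mult_left_mono lip) auto
    also have "\<dots> = \<epsilon> / (2 * b) * norm (x - y)" using K' by simp
    finally have 1: "norm (F (g x) - F (g y) - M (g x - g y)) \<le> \<epsilon> / (2 * b) * norm (x - y)" .
    have 2: "norm (G x - G y - N (x - y)) \<le> \<epsilon> / (2 * b) * norm (x - y)"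
      using d1 xy d by auto
    \<comment> \<open>In the difference of the two errors the values \<open>F (g x) = G x\<close>
      and \<open>F (g y) = G y\<close> cancel, leaving only linear terms.\<close>
    define r where "r = (G x - G y - N (x - y)) - (F (g x) - F (g y) - M (g x - g y))"
    have "r = M (g x - g y) - N (x - y)" by (simp add: r_def eq)
    then have "g x - g y - Mi (N (x - y)) = Mi r" by (simp add: linear_diff[OF Mi(1)] Mi(2))
    then have "norm (g x - g y - Mi (N (x - y))) \<le> b * norm r" using b by simp
    also have "\<dots> \<le> b * (\<epsilon> / (2 * b) * norm (x - y) + \<epsilon> / (2 * b) * norm (x - y))"
      using norm_triangle_ineq4[of "G x - G y - N (x - y)" "F (g x) - F (g y) - M (g x - g y)"] 1 2 b
      by (intro mult_left_mono) (auto simp: r_def)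
    also have "\<dots> = \<epsilon> * norm (x - y)" using b by (simp add: field_simps)
    finally show "norm (g x - g y - Mi (N (x - y))) \<le> \<epsilon> * norm (x - y)" .
  qed (use d in auto)
qed

text \<open>Mean value inequality on a ball where \<open>F'\<close> stays close to
  \<open>F' a\<close>, applied to \<open>F\<close> linearized at \<open>a\<close>.\<close>

lemma has_strict_derivative_C1:
  fixes F :: "real^'n \<Rightarrow> real^'m" and F' :: "real^'n \<Rightarrow> real^'n^'m"
  assumes der: "\<And>x. (F has_derivative (\<lambda>h. F' x *v h)) (at x)"
    and cont: "continuous_on UNIV F'"
  shows "has_strict_derivative F (\<lambda>h. F' a *v h) a"
  unfolding has_strict_derivative_def
proof (intro conjI allI impI)
  show "linear (\<lambda>h. F' a *v h)" by (rule matrix_vector_mul_linear)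
  fix \<epsilon> :: real assume e: "\<epsilon> > 0"
  \<comment> \<open>The number of entries turns the entrywise bound \<open>\<epsilon> / c\<close> on
    \<open>F' z - F' a\<close> into the operator norm bound \<open>\<epsilon>\<close>.\<close>
  define c where "c = real CARD('m) * real CARD('n)"
  have c: "c > 0" by (simp add: c_def)
  have "isCont F' a" using cont by (simp add: continuous_on_eq_continuous_at)
  then obtain d where d: "d > 0" "\<And>x. dist x a < d \<Longrightarrow> dist (F' x) (F' a) < \<epsilon> / c"
    using e c unfolding continuous_at_eps_delta by (metis divide_pos_pos)
  show "\<exists>\<delta>>0. \<forall>x\<in>ball a \<delta>. \<forall>y\<in>ball a \<delta>.
      norm (F x - F y - F' a *v (x - y)) \<le> \<epsilon> * norm (x - y)"
  proof (intro exI[of _ d] conjI ballI)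
    fix x y assume xy: "x \<in> ball a d" "y \<in> ball a d"
    have "norm (F x - F y - F' a *v (x - y)) \<le> norm (x - y) * \<epsilon>"
    proof (rule differentiable_bound_linearization[where S = "ball a d" and f' = "\<lambda>x h. F' x *v h"])
      fix t :: real assume "t \<in> {0..1}"
      then show "y + t *\<^sub>R (x - y) \<in> ball a d"
        using convexD_alt[OF convex_ball xy(2) xy(1), of t] by (simp add: algebra_simps)
    next
      fix z assume z: "z \<in> ball a d"
      show "(F has_derivative (\<lambda>h. F' z *v h)) (at z within ball a d)"
        using der by (rule has_derivative_at_withinI)
      have "norm (F' z - F' a) \<le> \<epsilon> / c" using d(2)[of z] z by (auto simp: dist_norm norm_minus_commute)
      then have "\<bar>(F' z - F' a) $ i $ j\<bar> \<le> \<epsilon> / c" for i j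
        using component_le_norm_cart[of "(F' z - F' a) $ i" j] Finite_Cartesian_Product.norm_nth_le[of "F' z - F' a" i] by linarith
      then have "onorm ((*v) (F' z - F' a)) \<le> c * (\<epsilon> / c)"
        unfolding c_def by (rule onorm_le_matrix_component)
      moreover have "(\<lambda>h. F' z *v h) - (\<lambda>h. F' a *v h) = (*v) (F' z - F' a)"
        by (auto simp: fun_eq_iff matrix_vector_mult_diff_rdistrib)
      ultimately show "onorm ((\<lambda>h. F' z *v h) - (\<lambda>h. F' a *v h)) \<le> \<epsilon>" using c by simp
    qed (use d in auto)
    then show "norm (F x - F y - F' a *v (x - y)) \<le> \<epsilon> * norm (x - y)" by (simp add: mult.commute)
  qed (use d in auto)
qed

section \<open>Unstable fixed points\<close>

text \<open>Self-adjointness makes the form depend only on the component of \<open>v\<close>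
  orthogonal to the kernel of \<open>H\<close>. There the displacement map is injective, hence
  bounded below by finite dimension.\<close>

lemma selfadjoint_form_le_displacement:
  fixes H A :: "'a::euclidean_space \<Rightarrow> 'a"
  assumes H: "linear H" and A: "linear A"
    and sym: "\<And>x y. x \<bullet> H y = H x \<bullet> y"
    and ker: "\<And>v. A v = v \<longleftrightarrow> H v = 0"
  obtains K where "K > 0" "\<And>v. \<bar>v \<bullet> H v\<bar> \<le> K * (norm (A v - v))\<^sup>2"
proof -
  define D where "D v = A v - v" for v
  have D: "linear D" unfolding D_def by (intro linear_compose_sub A linear_ident)
  define N where "N = {v. H v = 0}"
  have N: "subspace N" unfolding N_def using H by (rule linear_subspace_kernel)
  define R where "R = {y. \<forall>x\<in>N. orthogonal x y}"
  have R: "subspace R" unfolding R_def using subspace_orthogonal_to_vectors[of N]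
    by (simp add: orthogonal_commute)
  have "\<exists>e>0. \<forall>x\<in>R. norm (D x) \<ge> e * norm x"
  proof (rule injective_imp_isometric[OF closed_subspace[OF R] R])
    show "bounded_linear D" using D linear_conv_bounded_linear by blast
    show "\<forall>x\<in>R. D x = 0 \<longrightarrow> x = 0"
      using ker by (auto simp: R_def N_def D_def orthogonal_def)
  qed
  then obtain e where e: "e > 0" "\<And>x. x \<in> R \<Longrightarrow> e * norm x \<le> norm (D x)" by blast
  obtain b where b: "b > 0" "\<And>x. norm (H x) \<le> b * norm x"
    using linear_bounded_pos[OF H] by blast
  show ?thesis
  proof (rule that[of "b / e\<^sup>2"])
    fix v
    obtain y z where yz: "y \<in> span N" "\<And>w. w \<in> span N \<Longrightarrow> orthogonal z w" "v = y + z"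
      using orthogonal_subspace_decomp_exists[of N v] by blast
    have y: "H y = 0" using yz(1) N by (simp add: span_eq_iff[THEN iffD2] N_def)
    have z: "z \<in> R" using yz(2) N by (simp add: span_eq_iff[THEN iffD2] R_def orthogonal_commute)
    have Dv: "D v = D z" using y ker[of y] yz(3) linear_add[OF D, of y z] by (simp add: D_def)
    have "v \<bullet> H v = z \<bullet> H z"
      using y sym[of y z] yz(3) by (simp add: linear_add[OF H] inner_add_left)
    also have "\<bar>z \<bullet> H z\<bar> \<le> norm z * norm (H z)" by (rule Cauchy_Schwarz_ineq2)
    also have "\<dots> \<le> norm z * (b * norm z)" by (intro mult_left_mono b) simp
    also have "\<dots> = b / e\<^sup>2 * (e * norm z)\<^sup>2" using e by (simp add: power_mult_distrib power2_eq_square)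
    also have "\<dots> \<le> b / e\<^sup>2 * (norm (D z))\<^sup>2"
      using e z b by (intro mult_left_mono power_mono) auto
    finally show "\<bar>v \<bullet> H v\<bar> \<le> b / e\<^sup>2 * (norm (A v - v))\<^sup>2" using Dv by (simp add: D_def)
  qed (use b e in auto)
qed

text \<open>The perturbation by \<open>\<eta>\<close> excludes the kernel of \<open>H\<close>, on which \<open>A\<close> is the identity. It is
  harmless because on the cone the displacement \<open>A v - v\<close> is of order \<open>sqrt \<eta> * norm v\<close>, so that
  its square dominates the change of \<open>\<eta> * (norm v)\<^sup>2\<close>.\<close>

lemma expanding_cone:
  fixes H A :: "'a::euclidean_space \<Rightarrow> 'a"
  assumes H: "linear H" and A: "linear A"
    and sym: "\<And>x y. x \<bullet> H y = H x \<bullet> y"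
    and ker: "\<And>v. A v = v \<longleftrightarrow> H v = 0"
    and c: "c > 0" "\<And>v. A v \<bullet> H (A v) \<le> v \<bullet> H v - c * (norm (A v - v))\<^sup>2"
    and w: "w \<bullet> H w < 0"
  obtains B \<kappa> e where "linear B" "\<kappa> > 0" "e \<bullet> B e > 0"
    "\<And>v. v \<bullet> B v \<ge> 0 \<Longrightarrow> A v \<bullet> B (A v) \<ge> v \<bullet> B v + \<kappa> * (norm v)\<^sup>2"
proof -
  obtain K where K: "K > 0" "\<And>v. \<bar>v \<bullet> H v\<bar> \<le> K * (norm (A v - v))\<^sup>2"
    using selfadjoint_form_le_displacement[OF H A sym ker] by metis
  have w0: "w \<noteq> 0" using w by auto
  \<comment> \<open>\<open>s\<close> is the square root of \<open>\<eta>\<close>. The three bounds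
    give, in order: the form is positive at \<open>w\<close>; \<open>\<eta> \<le> c / 4\<close>; and
    \<open>\<eta> * norm v \<le> c / 8 * norm (A v - v)\<close> for \<open>v\<close> in the
    cone.\<close>
  define s where "s = min (sqrt (- (w \<bullet> H w) / (2 * (w \<bullet> w)))) (min (sqrt (c / 4)) (c / (8 * sqrt K)))"
  have s: "s > 0" using w w0 c K by (auto simp: s_def divide_neg_pos)
  define \<eta> where "\<eta> = s\<^sup>2"
  have eta: "\<eta> > 0" using s by (simp add: \<eta>_def)
  have s1: "\<eta> * (w \<bullet> w) < - (w \<bullet> H w)"
  proof -
    have "s\<^sup>2 \<le> (sqrt (- (w \<bullet> H w) / (2 * (w \<bullet> w))))\<^sup>2"
      using s by (intro power_mono) (auto simp: s_def)
    also have "\<dots> = - (w \<bullet> H w) / (2 * (w \<bullet> w))" using w by (intro real_sqrt_pow2) (auto simp: divide_nonpos_nonneg)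
    finally have "2 * (\<eta> * (w \<bullet> w)) \<le> - (w \<bullet> H w)" using w0 by (simp add: \<eta>_def field_simps)
    moreover have "\<eta> * (w \<bullet> w) > 0" using eta w0 by simp
    ultimately show ?thesis by linarith
  qed
  have s2: "\<eta> \<le> c / 4"
  proof -
    have "s\<^sup>2 \<le> (sqrt (c / 4))\<^sup>2" using s by (intro power_mono) (auto simp: s_def)
    then show ?thesis using c by (simp add: \<eta>_def)
  qed
  have s3: "s * sqrt K * 8 \<le> c"
  proof -
    have "s \<le> c / (8 * sqrt K)" by (simp add: s_def)
    then show ?thesis using K(1) by (simp add: field_simps)
  qed
  define B where "B v = - H v - \<eta> *\<^sub>R v" for v
  have B: "linear B" unfolding B_def
    by (intro linear_compose_sub linear_compose_neg H) (simp add: linear_scale_self)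
  have form: "v \<bullet> B v = - (v \<bullet> H v) - \<eta> * (norm v)\<^sup>2" for v
    by (simp add: B_def inner_diff_right dot_square_norm)
  show ?thesis
  proof (rule that[of B "\<eta> * c / (4 * K)" w])
    show "linear B" by (rule B)
    show "\<eta> * c / (4 * K) > 0" using eta c K by simp
    show "w \<bullet> B w > 0" using s1 by (simp add: form dot_square_norm)
    fix v assume v: "v \<bullet> B v \<ge> 0"
    define d where "d = norm (A v - v)"
    \<comment> \<open>Membership in the cone bounds the left side by
      \<open>- (v \<bullet> H v)\<close>, which the displacement controls.\<close>
    have "\<eta> * (norm v)\<^sup>2 \<le> K * d\<^sup>2" using v K(2)[of v] by (simp add: form d_def)
    then have le: "(s * norm v)\<^sup>2 \<le> (sqrt K * d)\<^sup>2" using K(1) by (simp add: \<eta>_def power_mult_distrib)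
    then have "s * norm v \<le> sqrt K * d"
      by (rule power2_le_imp_le) (use K(1) in \<open>simp add: d_def\<close>)
    then have "s * (s * norm v) \<le> s * (sqrt K * d)" using s by (intro mult_left_mono) auto
    then have "\<eta> * norm v \<le> (s * sqrt K) * d" by (simp add: \<eta>_def power2_eq_square mult_ac)
    also have "\<dots> \<le> c / 8 * d" using s3 by (intro mult_right_mono) (auto simp: d_def)
    finally have 1: "\<eta> * norm v * d \<le> c / 8 * d * d" by (rule mult_right_mono) (simp add: d_def)
    have "norm (A v) \<le> norm v + d" using norm_triangle_ineq[of v "A v - v"] by (simp add: d_def)
    then have "(norm (A v))\<^sup>2 \<le> (norm v + d)\<^sup>2" by (intro power_mono) auto
    then have "\<eta> * (norm (A v))\<^sup>2 \<le> \<eta> * (norm v + d)\<^sup>2" using eta by simp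
    also have "\<dots> = \<eta> * (norm v)\<^sup>2 + 2 * (\<eta> * norm v * d) + \<eta> * d\<^sup>2"
      by (simp add: power2_eq_square algebra_simps)
    also have "\<dots> \<le> \<eta> * (norm v)\<^sup>2 + 2 * (c / 8 * d * d) + c / 4 * d\<^sup>2"
      using 1 s2 by (intro add_mono mult_right_mono) auto
    finally have 2: "\<eta> * (norm (A v))\<^sup>2 \<le> \<eta> * (norm v)\<^sup>2 + c / 2 * d\<^sup>2"
      by (simp add: power2_eq_square)
    \<comment> \<open>Of the gain \<open>c * d\<^sup>2\<close>, half pays for the growth of
      \<open>\<eta> * (norm v)\<^sup>2\<close> under \<open>A\<close>; a quarter covers the
      \<open>\<kappa>\<close> term.\<close>
    have "\<eta> * c / (4 * K) * (norm v)\<^sup>2 = c / (4 * K) * (\<eta> * (norm v)\<^sup>2)" by simp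
    also have "\<dots> \<le> c / (4 * K) * (K * d\<^sup>2)"
      using \<open>\<eta> * (norm v)\<^sup>2 \<le> K * d\<^sup>2\<close> c K by (intro mult_left_mono) auto
    also have "\<dots> = c / 4 * d\<^sup>2" using K by simp
    finally have 3: "\<eta> * c / (4 * K) * (norm v)\<^sup>2 \<le> c / 4 * d\<^sup>2" .
    have "c * d\<^sup>2 \<ge> 0" using c by simp
    then show "A v \<bullet> B (A v) \<ge> v \<bullet> B v + \<eta> * c / (4 * K) * (norm v)\<^sup>2"
      using c(2)[of v] 2 3 unfolding form d_def[symmetric] by linarith
  qed
qed

text \<open>Two orbits whose difference starts in the expanding cone would separate indefinitely.\<close>

lemma negligible_trapped_near_unstable_fixpoint:
  fixes g A B :: "'a::euclidean_space \<Rightarrow> 'a"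
  assumes g: "has_strict_derivative g A a"
    and B: "linear B" and kappa: "\<kappa> > 0" and e: "e \<bullet> B e > 0"
    and expand: "\<And>v. v \<bullet> B v \<ge> 0 \<Longrightarrow> A v \<bullet> B (A v) \<ge> v \<bullet> B v + \<kappa> * (norm v)\<^sup>2"
  obtains \<delta> where "\<delta> > 0" "negligible {x. \<forall>k. (g ^^ k) x \<in> ball a \<delta>}"
proof -
  have A: "linear A" using g by (simp add: has_strict_derivative_def)
  obtain b where b: "b > 0" "\<And>x. norm (B x) \<le> b * norm x"
    using linear_bounded_pos[OF B] by blast
  obtain k where k: "k > 0" "\<And>x. norm (A x) \<le> k * norm x"
    using linear_bounded_pos[OF A] by blast
  \<comment> \<open>Replacing \<open>A v\<close> by \<open>A v + r\<close> with
    \<open>norm r \<le> \<epsilon> * norm v\<close> changes the form by at most \<open>b * (2 * k *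
    \<epsilon> + \<epsilon>\<^sup>2) * (norm v)\<^sup>2\<close>; since
    \<open>\<epsilon> \<le> 1\<close>, this costs at most half of the gain
    \<open>\<kappa> * (norm v)\<^sup>2\<close>.\<close>
  define \<epsilon> where "\<epsilon> = min 1 (\<kappa> / (2 * b * (2 * k + 1)))"
  have eps: "\<epsilon> > 0" "\<epsilon> \<le> 1" "b * (2 * k + 1) * \<epsilon> \<le> \<kappa> / 2"
  proof -
    have "b * (2 * k + 1) > 0" using b k by simp
    then show "\<epsilon> > 0" "\<epsilon> \<le> 1" using kappa b k by (auto simp: \<epsilon>_def)
    have "b * (2 * k + 1) * \<epsilon> \<le> b * (2 * k + 1) * (\<kappa> / (2 * b * (2 * k + 1)))"
      using \<open>b * (2 * k + 1) > 0\<close> by (intro mult_left_mono) (auto simp: \<epsilon>_def)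
    also have "\<dots> = \<kappa> / 2" using b k \<open>b * (2 * k + 1) > 0\<close> by (simp add: field_simps)
    finally show "b * (2 * k + 1) * \<epsilon> \<le> \<kappa> / 2" .
  qed
  obtain \<delta> where d: "\<delta> > 0" "\<And>x y. x \<in> ball a \<delta> \<Longrightarrow> y \<in> ball a \<delta> \<Longrightarrow>
      norm (g x - g y - A (x - y)) \<le> \<epsilon> * norm (x - y)"
    using has_strict_derivativeD[OF g eps(1)] by metis
  have cs: "\<bar>u \<bullet> B v\<bar> \<le> b * (norm u * norm v)" for u v
  proof -
    have "\<bar>u \<bullet> B v\<bar> \<le> norm u * norm (B v)" by (rule Cauchy_Schwarz_ineq2)
    also have "\<dots> \<le> norm u * (b * norm v)" by (intro mult_left_mono b) simp
    finally show ?thesis by (simp add: mult_ac)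
  qed
  have step: "(g x - g y) \<bullet> B (g x - g y) \<ge> (x - y) \<bullet> B (x - y) + \<kappa> / 2 * (norm (x - y))\<^sup>2"
    if xy: "x \<in> ball a \<delta>" "y \<in> ball a \<delta>" and pos: "(x - y) \<bullet> B (x - y) \<ge> 0" for x y
  proof -
    define v where "v = x - y"
    define r where "r = g x - g y - A v"
    have r: "norm r \<le> \<epsilon> * norm v" using d(2)[OF xy] by (simp add: r_def v_def)
    have eq: "(g x - g y) \<bullet> B (g x - g y) = A v \<bullet> B (A v) + A v \<bullet> B r + r \<bullet> B (A v) + r \<bullet> B r"
    proof -
      have "g x - g y = A v + r" by (simp add: r_def)
      then show ?thesis by (simp add: linear_add[OF B] inner_add_left inner_add_right)
    qed
    have "norm (A v) * norm r \<le> (k * norm v) * (\<epsilon> * norm v)"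
      using k r eps by (intro mult_mono) auto
    then have a1: "b * (norm (A v) * norm r) \<le> b * ((k * norm v) * (\<epsilon> * norm v))"
      using b by simp
    have "norm r * norm r \<le> (\<epsilon> * norm v) * (\<epsilon> * norm v)"
      using r eps by (intro mult_mono) auto
    also have "\<dots> \<le> norm v * (\<epsilon> * norm v)"
      using eps by (intro mult_right_mono) (auto simp: mult_left_le_one_le)
    finally have a2: "b * (norm r * norm r) \<le> b * (norm v * (\<epsilon> * norm v))" using b by simp
    have "b * (2 * k + 1) * \<epsilon> * (norm v)\<^sup>2 \<le> \<kappa> / 2 * (norm v)\<^sup>2"
      using eps(3) by (intro mult_right_mono) auto
    then have a3: "2 * (b * ((k * norm v) * (\<epsilon> * norm v))) + b * (norm v * (\<epsilon> * norm v)) \<le> \<kappa> / 2 * (norm v)\<^sup>2"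
      by (simp add: algebra_simps power2_eq_square)
    have "A v \<bullet> B (A v) \<ge> v \<bullet> B v + \<kappa> * (norm v)\<^sup>2" using expand pos by (simp add: v_def)
    moreover have "\<kappa> * (norm v)\<^sup>2 = \<kappa> / 2 * (norm v)\<^sup>2 + \<kappa> / 2 * (norm v)\<^sup>2" by simp
    ultimately show ?thesis
      using eq cs[of "A v" r] cs[of r "A v"] cs[of r r] a1 a2 a3
      unfolding v_def[symmetric] abs_le_iff mult.commute[of "norm r" "norm (A v)"] by linarith
  qed
  define W where "W = {x. \<forall>k. (g ^^ k) x \<in> ball a \<delta>}"
  have "(x - y) \<bullet> B (x - y) \<le> 0" if x: "x \<in> W" and y: "y \<in> W" for x y
  proof (rule ccontr)
    define P where "P n = ((g ^^ n) x - (g ^^ n) y) \<bullet> B ((g ^^ n) x - (g ^^ n) y)" for n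
    assume "\<not> (x - y) \<bullet> B (x - y) \<le> 0"
    then have P0: "P 0 > 0" by (simp add: P_def)
    \<comment> \<open>As \<open>P\<close> never drops below \<open>P 0\<close>, the squared distance
      of the orbits stays at least \<open>P 0 / b\<close>, so every step gains at least
      \<open>\<theta>\<close>. Unbounded growth contradicts the bound on \<open>P\<close> coming
      from the ball.\<close>
    define \<theta> where "\<theta> = \<kappa> / 2 * (P 0 / b)"
    have th: "\<theta> > 0" using kappa P0 b by (simp add: \<theta>_def)
    have up: "P n \<le> b * (norm ((g ^^ n) x - (g ^^ n) y))\<^sup>2" for n
      using cs[of "(g ^^ n) x - (g ^^ n) y" "(g ^^ n) x - (g ^^ n) y"]
      by (simp add: P_def power2_eq_square)
    have grow: "P n \<ge> P 0 + real n * \<theta>" for n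
    proof (induction n)
      case (Suc n)
      have nt: "real n * \<theta> \<ge> 0" using th by simp
      have "P (Suc n) \<ge> P n + \<kappa> / 2 * (norm ((g ^^ n) x - (g ^^ n) y))\<^sup>2"
        using step[of "(g ^^ n) x" "(g ^^ n) y"] x y Suc P0 nt by (simp add: P_def W_def)
      moreover have "P 0 / b \<le> (norm ((g ^^ n) x - (g ^^ n) y))\<^sup>2"
        using up[of n] Suc nt b by (simp add: field_simps)
      then have "\<theta> \<le> \<kappa> / 2 * (norm ((g ^^ n) x - (g ^^ n) y))\<^sup>2"
        unfolding \<theta>_def using kappa by (intro mult_left_mono) auto
      ultimately show ?case using Suc by (simp add: algebra_simps)
    qed simp
    obtain n where n: "real n * \<theta> > b * (2 * \<delta>)\<^sup>2" using reals_Archimedean3[OF th] by blast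
    have "norm ((g ^^ n) x - (g ^^ n) y) \<le> 2 * \<delta>"
    proof -
      have "dist a ((g ^^ n) x) < \<delta>" "dist a ((g ^^ n) y) < \<delta>" using x y by (auto simp: W_def)
      then show ?thesis using dist_triangle3[of "(g ^^ n) x" "(g ^^ n) y" a] by (simp add: dist_norm)
    qed
    then have "b * (norm ((g ^^ n) x - (g ^^ n) y))\<^sup>2 \<le> b * (2 * \<delta>)\<^sup>2"
      using b by (intro mult_left_mono power_mono) auto
    then show False using n grow[of n] up[of n] P0 by linarith
  qed
  then have "negligible W" using negligible_avoiding_quadratic_cone[OF B e] by blast
  then show ?thesis using that d(1) unfolding W_def by blast
qed

text \<open>A convergent orbit eventually stays in one of countably many balls, so some iterate lies
  in the trapped set of that ball, and \<open>pre\<close> pulls null sets back through the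
  iterates.\<close>

lemma negligible_convergent_to_locally_unstable_points:
  fixes g :: "'a::euclidean_space \<Rightarrow> 'a"
  assumes pre: "\<And>N. negligible N \<Longrightarrow> negligible {x. g x \<in> N}"
    and loc: "\<And>a. a \<in> S \<Longrightarrow> \<exists>\<delta>>0. negligible {x. \<forall>k. (g ^^ k) x \<in> ball a \<delta>}"
  shows "negligible {x. \<exists>a\<in>S. (\<lambda>k. (g ^^ k) x) \<longlonglongrightarrow> a}"
proof -
  obtain r where r: "\<And>a. a \<in> S \<Longrightarrow> r a > 0"
    "\<And>a. a \<in> S \<Longrightarrow> negligible {x. \<forall>k. (g ^^ k) x \<in> ball a (r a)}"
    using loc by metis
  define \<F> where "\<F> = (\<lambda>a. ball a (r a)) ` S"
  obtain \<G> where G: "\<G> \<subseteq> \<F>" "countable \<G>" "\<Union>\<G> = \<Union>\<F>"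
    using Lindelof[of \<F>] by (auto simp: \<F>_def)
  define W where "W U = {x. \<forall>k. (g ^^ k) x \<in> U}" for U
  have preN: "negligible {x. (g ^^ m) x \<in> N}" if "negligible N" for m N
    using that
  proof (induction m arbitrary: N)
    case (Suc m)
    show ?case using Suc.IH[OF pre[OF Suc.prems]] by simp
  qed simp
  have "negligible (\<Union>U\<in>\<G>. \<Union>m. {x. (g ^^ m) x \<in> W U})"
  proof (rule negligible_countable_Union)
    show "countable ((\<lambda>U. \<Union>m. {x. (g ^^ m) x \<in> W U}) ` \<G>)" using G by simp
    fix T assume "T \<in> (\<lambda>U. \<Union>m. {x. (g ^^ m) x \<in> W U}) ` \<G>"
    then obtain U where U: "U \<in> \<G>" "T = (\<Union>m. {x. (g ^^ m) x \<in> W U})" by blast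
    then obtain a where "a \<in> S" "U = ball a (r a)" using G by (auto simp: \<F>_def)
    then have "negligible (W U)" using r by (simp add: W_def)
    then show "negligible T" unfolding U(2) by (intro negligible_Union_nat preN)
  qed
  moreover have "{x. \<exists>a\<in>S. (\<lambda>k. (g ^^ k) x) \<longlonglongrightarrow> a} \<subseteq> (\<Union>U\<in>\<G>. \<Union>m. {x. (g ^^ m) x \<in> W U})"
  proof clarify
    fix x a assume a: "a \<in> S" and lim: "(\<lambda>k. (g ^^ k) x) \<longlonglongrightarrow> a"
    have "a \<in> \<Union>\<F>" using a r(1) by (force simp: \<F>_def)
    \<comment> \<open>\<open>U\<close> need not be centred at \<open>a\<close>: openness suffices to
      capture the tail, and the trapped set of \<open>U\<close> is null by the choice of radius at
      its own centre.\<close>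
    then obtain U where U: "U \<in> \<G>" "a \<in> U" using G by blast
    have "open U" using U G by (auto simp: \<F>_def)
    then obtain m where m: "\<And>k. k \<ge> m \<Longrightarrow> (g ^^ k) x \<in> U"
      using topological_tendstoD[OF lim _ U(2)] unfolding eventually_sequentially by blast
    have "(g ^^ m) x \<in> W U"
      using m by (simp add: W_def flip: funpow_add[unfolded o_def, THEN fun_cong])
    then show "x \<in> (\<Union>U\<in>\<G>. \<Union>m. {x. (g ^^ m) x \<in> W U})" using U by blast
  qed
  ultimately show ?thesis by (rule negligible_subset)
qed

section \<open>Hessians and their least eigenvalue\<close>

text \<open>The second difference of \<open>f\<close> is a first difference of
  \<open>\<psi>\<close>; the mean value theorem turns it into a difference of gradients, which
  \<open>est\<close> compares with \<open>t *\<^sub>R H v\<close>.\<close>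

lemma second_difference_estimate:
  fixes f :: "'a::euclidean_space \<Rightarrow> real"
  assumes grad: "\<And>x. (f has_derivative (\<lambda>h. h \<bullet> f' x)) (at x)"
    and t: "t > 0"
    and est: "\<And>x y. x \<in> ball a \<delta> \<Longrightarrow> y \<in> ball a \<delta> \<Longrightarrow> norm (f' x - f' y - H (x - y)) \<le> \<epsilon> * norm (x - y)"
    and H: "linear H"
    and small: "t * (norm u + norm v) < \<delta>"
  shows "\<bar>f (a + t *\<^sub>R u + t *\<^sub>R v) - f (a + t *\<^sub>R u) - f (a + t *\<^sub>R v) + f a - t\<^sup>2 * (u \<bullet> H v)\<bar>
    \<le> t\<^sup>2 * (\<epsilon> * norm u * norm v)"
proof -
  define \<psi> where "\<psi> s = f (a + s *\<^sub>R u + t *\<^sub>R v) - f (a + s *\<^sub>R u)" for s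
  define G where "G s = f' (a + s *\<^sub>R u + t *\<^sub>R v) - f' (a + s *\<^sub>R u)" for s
  have "DERIV \<psi> s :> u \<bullet> G s" for s
    unfolding \<psi>_def G_def has_field_derivative_def
    by (rule derivative_eq_intros has_derivative_compose[OF _ grad] refl | simp)+
      (simp add: fun_eq_iff inner_diff_right algebra_simps)
  then obtain s where s: "0 < s" "s < t" "\<psi> t - \<psi> 0 = (t - 0) * (u \<bullet> G s)"
    using MVT2[OF t, of \<psi> "\<lambda>s. u \<bullet> G s"] by blast
  have su: "norm (s *\<^sub>R u) \<le> t * norm u" using s by (simp add: mult_right_mono)
  have "norm (s *\<^sub>R u + t *\<^sub>R v) \<le> t * (norm u + norm v)"
    using norm_triangle_ineq[of "s *\<^sub>R u" "t *\<^sub>R v"] su t by (simp add: algebra_simps)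
  moreover have "t * norm u \<le> t * (norm u + norm v)" using t by simp
  ultimately have "a + s *\<^sub>R u + t *\<^sub>R v \<in> ball a \<delta>" "a + s *\<^sub>R u \<in> ball a \<delta>"
    using small su norm_minus_cancel[of "s *\<^sub>R u + t *\<^sub>R v"] by (auto simp: dist_norm add.assoc)
  from est[OF this] have "norm (G s - t *\<^sub>R H v) \<le> \<epsilon> * (t * norm v)"
    using t by (simp add: G_def linear_scale[OF H])
  then have "\<bar>u \<bullet> (G s - t *\<^sub>R H v)\<bar> \<le> norm u * (\<epsilon> * (t * norm v))"
    using Cauchy_Schwarz_ineq2[of u "G s - t *\<^sub>R H v"] mult_left_mono[OF _ norm_ge_zero[of u]]
    by (meson order_trans)
  then have "t * \<bar>u \<bullet> (G s - t *\<^sub>R H v)\<bar> \<le> t * (norm u * (\<epsilon> * (t * norm v)))"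
    using t by simp
  moreover have "f (a + t *\<^sub>R u + t *\<^sub>R v) - f (a + t *\<^sub>R u) - f (a + t *\<^sub>R v) + f a - t\<^sup>2 * (u \<bullet> H v)
      = t * (u \<bullet> (G s - t *\<^sub>R H v))"
    using s(3) by (simp add: \<psi>_def inner_diff_right power2_eq_square algebra_simps)
  ultimately show ?thesis using t by (simp add: abs_mult power2_eq_square mult_ac)
qed

text \<open>The second difference is symmetric in \<open>u\<close> and \<open>v\<close> and
  approximates both \<open>t\<^sup>2 * (u \<bullet> H v)\<close> and
  \<open>t\<^sup>2 * (v \<bullet> H u)\<close>; dividing by \<open>t\<^sup>2\<close> leaves an
  arbitrarily small error.\<close>

lemma strict_derivative_of_gradient_selfadjoint:
  fixes f :: "'a::euclidean_space \<Rightarrow> real"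
  assumes grad: "\<And>x. (f has_derivative (\<lambda>h. h \<bullet> f' x)) (at x)"
    and hess: "has_strict_derivative f' H a"
  shows "u \<bullet> H v = H u \<bullet> v"
proof -
  have H: "linear H" using hess by (simp add: has_strict_derivative_def)
  have "\<bar>u \<bullet> H v - v \<bullet> H u\<bar> \<le> 0 + e" if e: "e > 0" for e
  proof -
    define \<epsilon> where "\<epsilon> = e / (2 * (norm u * norm v + 1))"
    have pos: "norm u * norm v + 1 > 0" by (simp add: add_nonneg_pos)
    then have eps: "\<epsilon> > 0" using e by (simp add: \<epsilon>_def)
    have "2 * \<epsilon> * (norm u * norm v) \<le> 2 * \<epsilon> * (norm u * norm v + 1)" using eps by simp
    also have "\<dots> = e" using pos by (simp add: \<epsilon>_def field_simps)
    finally have le: "2 * \<epsilon> * (norm u * norm v) \<le> e" .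
    obtain \<delta> where d: "\<delta> > 0" "\<And>x y. x \<in> ball a \<delta> \<Longrightarrow> y \<in> ball a \<delta> \<Longrightarrow>
        norm (f' x - f' y - H (x - y)) \<le> \<epsilon> * norm (x - y)"
      using has_strict_derivativeD[OF hess eps] by metis
    define t where "t = \<delta> / (norm u + norm v + 1)"
    have pos': "norm u + norm v + 1 > 0" by (simp add: add_nonneg_pos)
    have t: "t > 0" using d pos' by (simp add: t_def)
    have "t * (norm u + norm v + 1) = \<delta>" using pos' by (simp add: t_def)
    then have small: "t * (norm u + norm v) < \<delta>" using t by (simp add: algebra_simps)
    then have small': "t * (norm v + norm u) < \<delta>" by (simp add: add.commute)
    note 1 = second_difference_estimate[where a = a, OF grad t d(2) H small]
    note 2 = second_difference_estimate[where a = a, OF grad t d(2) H small']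
    have comm: "a + t *\<^sub>R v + t *\<^sub>R u = a + t *\<^sub>R u + t *\<^sub>R v" by simp
    have "\<bar>t\<^sup>2 * (u \<bullet> H v) - t\<^sup>2 * (v \<bullet> H u)\<bar> \<le> t\<^sup>2 * (2 * \<epsilon> * (norm u * norm v))"
      using 1 2 unfolding comm by (simp add: algebra_simps)
    then have "t\<^sup>2 * \<bar>u \<bullet> H v - v \<bullet> H u\<bar> \<le> t\<^sup>2 * (2 * \<epsilon> * (norm u * norm v))"
      by (simp add: abs_mult flip: right_diff_distrib)
    then have "\<bar>u \<bullet> H v - v \<bullet> H u\<bar> \<le> 2 * \<epsilon> * (norm u * norm v)" using t by simp
    then show ?thesis using le by simp
  qed
  then have "\<bar>u \<bullet> H v - v \<bullet> H u\<bar> \<le> 0" by (rule field_le_epsilon)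
  then show ?thesis by (simp add: inner_commute)
qed

text \<open>A minimizer of the Rayleigh quotient on the unit sphere is an eigenvector, with the
  minimum \<open>m\<close> as eigenvalue.\<close>

lemma selfadjoint_real_eigenvalues_nonempty:
  fixes A :: "real^'n^'n"
  assumes sym: "\<And>x y. x \<bullet> (A *v y) = (A *v x) \<bullet> y"
  shows "real_eigenvalues A \<noteq> {}"
proof -
  have "\<exists>v\<in>sphere 0 1. \<forall>w\<in>sphere 0 1. v \<bullet> (A *v v) \<le> w \<bullet> (A *v w)"
  proof (rule continuous_attains_inf)
    have "axis undefined 1 \<in> sphere (0::real^'n) 1" by simp
    then show "sphere (0::real^'n) 1 \<noteq> {}" by blast
    show "continuous_on (sphere 0 1) (\<lambda>v. v \<bullet> (A *v v))"
      by (intro continuous_intros linear_continuous_on_compose[OF _ matrix_vector_mul_linear])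
  qed simp
  then obtain v where v: "norm v = 1" "\<And>w. norm w = 1 \<Longrightarrow> v \<bullet> (A *v v) \<le> w \<bullet> (A *v w)" by auto
  define m where "m = v \<bullet> (A *v v)"
  have le: "m * (w \<bullet> w) \<le> w \<bullet> (A *v w)" for w
  proof (cases "w = 0")
    case False
    have "m \<le> (w /\<^sub>R norm w) \<bullet> (A *v (w /\<^sub>R norm w))" unfolding m_def using False by (intro v) simp
    also have "\<dots> = (w \<bullet> (A *v w)) / (w \<bullet> w)"
      by (simp add: matrix_vector_mult_scaleR dot_square_norm power2_eq_square divide_simps)
    finally show ?thesis using False by (simp add: field_simps)
  qed simp
  \<comment> \<open>\<open>r\<close> is the residual of the eigenvalue equation. Along
    \<open>v + t *\<^sub>R r\<close> the nonnegative form
    \<open>w \<bullet> (A *v w) - m * (w \<bullet> w)\<close> vanishes at \<open>t = 0\<close> with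
    slope \<open>2 * (r \<bullet> r)\<close>, which forces \<open>r = 0\<close>.\<close>
  define r where "r = A *v v - m *\<^sub>R v"
  define k where "k = r \<bullet> (A *v r) - m * (r \<bullet> r)"
  have quad: "0 \<le> 2 * t * (r \<bullet> r) + t\<^sup>2 * k" for t
  proof -
    have "(v + t *\<^sub>R r) \<bullet> (A *v (v + t *\<^sub>R r)) - m * ((v + t *\<^sub>R r) \<bullet> (v + t *\<^sub>R r))
        = (m - m * (v \<bullet> v)) + 2 * t * (r \<bullet> (A *v v) - m * (r \<bullet> v)) + t\<^sup>2 * k"
      using sym[of v r]
      by (simp add: m_def k_def matrix_vector_right_distrib matrix_vector_mult_scaleR inner_add_left
          inner_add_right inner_commute power2_eq_square algebra_simps)
    moreover have "r \<bullet> (A *v v) - m * (r \<bullet> v) = r \<bullet> r" by (simp add: r_def inner_diff_right)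
    moreover have "v \<bullet> v = 1" using v by (simp add: dot_square_norm)
    ultimately show ?thesis using le[of "v + t *\<^sub>R r"] by simp
  qed
  have "r = 0"
  proof (rule ccontr)
    assume "r \<noteq> 0"
    then have q: "r \<bullet> r > 0" by simp
    \<comment> \<open>Small enough that at \<open>t = - T\<close> the linear term outweighs the
      quadratic one.\<close>
    define T where "T = (r \<bullet> r) / (\<bar>k\<bar> + 1)"
    have T: "T > 0" using q by (simp add: T_def add_nonneg_pos)
    have "T * \<bar>k\<bar> \<le> T * (\<bar>k\<bar> + 1)" using T by simp
    also have "\<dots> = r \<bullet> r" by (simp add: T_def)
    finally have "T * k \<le> r \<bullet> r" using T by (smt (verit) mult_left_mono abs_ge_self)
    then have "T * (T * k) \<le> T * (r \<bullet> r)" using T by simp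
    moreover have "T * (r \<bullet> r) > 0" using T q by simp
    ultimately show False using quad[of "- T"] by (simp add: power2_eq_square mult.assoc)
  qed
  then have "A *v v = m *\<^sub>R v" by (simp add: r_def)
  moreover have "v \<noteq> 0" using v by auto
  ultimately show ?thesis by (auto simp: real_eigenvalues_def)
qed

text \<open>Eigenvectors for distinct eigenvalues are orthogonal, and orthogonal families in finite
  dimension are finite.\<close>

lemma selfadjoint_real_eigenvalues_finite:
  fixes A :: "real^'n^'n"
  assumes sym: "\<And>x y. x \<bullet> (A *v y) = (A *v x) \<bullet> y"
  shows "finite (real_eigenvalues A)"
proof -
  obtain w where w: "\<And>c. c \<in> real_eigenvalues A \<Longrightarrow> w c \<noteq> 0 \<and> A *v w c = c *\<^sub>R w c"
  proof -
    have "\<forall>c\<in>real_eigenvalues A. \<exists>v. v \<noteq> 0 \<and> A *v v = c *\<^sub>R v"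
      by (auto simp: real_eigenvalues_def)
    then show ?thesis using that by metis
  qed
  have orth: "w c \<bullet> w d = 0" if "c \<in> real_eigenvalues A" "d \<in> real_eigenvalues A" "c \<noteq> d" for c d
    using sym[of "w c" "w d"] w[OF that(1)] w[OF that(2)] that(3) by auto
  have "inj_on w (real_eigenvalues A)"
    using orth w by (auto simp: inj_on_def) (metis inner_eq_zero_iff)
  moreover have "finite (w ` real_eigenvalues A)"
    using orth by (intro pairwise_orthogonal_imp_finite) (auto simp: pairwise_def orthogonal_def)
  ultimately show ?thesis using finite_imageD by blast
qed

text \<open>Finiteness and nonemptiness of the spectrum make the \<open>Min\<close> in
  \<open>lambda_min\<close> an actual eigenvalue; its eigenvector is the direction.\<close>

lemma lambda_min_neg_imp_negative_direction:
  fixes A :: "real^'n^'n"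
  assumes sym: "\<And>x y. x \<bullet> (A *v y) = (A *v x) \<bullet> y" and neg: "lambda_min A < 0"
  obtains v where "v \<bullet> (A *v v) < 0"
proof -
  have "lambda_min A \<in> real_eigenvalues A"
    unfolding lambda_min_def
    using selfadjoint_real_eigenvalues_finite selfadjoint_real_eigenvalues_nonempty sym
    by (intro Min_in) blast+
  then obtain v where "v \<noteq> 0" "A *v v = lambda_min A *\<^sub>R v" by (auto simp: real_eigenvalues_def)
  then have "v \<bullet> (A *v v) < 0" using neg by (simp add: mult_neg_pos)
  then show ?thesis by (rule that)
qed

section \<open>The block update\<close>

definition block_proj :: "'n set \<Rightarrow> real^'n \<Rightarrow> real^'n" where
  "block_proj J v = (\<chi> i. if i \<in> J then v $ i else 0)"

lemma block_proj_nth: "block_proj J v $ i = (if i \<in> J then v $ i else 0)"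
  by (simp add: block_proj_def)

lemma linear_block_proj: "linear (block_proj J)"
  by (rule linearI) (auto simp: vec_eq_iff block_proj_nth)

lemma block_proj_idem: "block_proj J (block_proj J v) = block_proj J v"
  by (simp add: vec_eq_iff block_proj_nth)

lemma inner_block_proj: "block_proj J u \<bullet> v = (\<Sum>i\<in>J. u $ i * v $ i)"
  unfolding inner_vec_def by (simp add: block_proj_nth if_distrib[of "\<lambda>a. a * _"] sum.If_cases cong: if_cong)

lemma inner_block_proj_right: "u \<bullet> block_proj J v = block_proj J u \<bullet> v"
  unfolding inner_vec_def by (auto simp: block_proj_nth intro!: sum.cong)

lemma norm_block_proj_compl_le: "norm (v - block_proj J v) \<le> norm v"
  by (rule norm_le_componentwise_cart) (auto simp: block_proj_nth)

lemma same_off_iff_block_proj: "same_off J x y \<longleftrightarrow> block_proj J (y - x) = y - x"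
  by (auto simp: same_off_def vec_eq_iff block_proj_nth)

text \<open>The data of one block, interpreted once for each \<open>s < p\<close>. The step size
  condition refers to the \<open>\<mu>\<close> of this block, in product form.\<close>

locale block_step =
  fixes J :: "'n::finite set" and f' :: "real^'n \<Rightarrow> real^'n" and f'' :: "real^'n \<Rightarrow> real^'n^'n"
    and \<phi> :: "real^'n \<Rightarrow> real" and \<phi>' :: "real^'n \<Rightarrow> real^'n" and \<phi>'' :: "real^'n \<Rightarrow> real^'n^'n"
    and \<mu> L \<alpha> :: real
  assumes f_hess: "\<And>x. (f' has_derivative (\<lambda>h. f'' x *v h)) (at x)"
    and f_C2: "continuous_on UNIV f''"
    and hess_bound: "\<And>x. onorm (\<lambda>h. f'' x *v h) \<le> L"
    and L_pos: "L > 0"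
    and phi_block: "\<And>x y. (\<forall>i\<in>J. x $ i = y $ i) \<Longrightarrow> \<phi> x = \<phi> y"
    and phi_grad: "\<And>x. (\<phi> has_derivative (\<lambda>h. h \<bullet> \<phi>' x)) (at x)"
    and phi_hess: "\<And>x. (\<phi>' has_derivative (\<lambda>h. \<phi>'' x *v h)) (at x)"
    and phi_C2: "continuous_on UNIV \<phi>''"
    and mu_pos: "\<mu> > 0"
    and strongly_convex: "\<And>x y. same_off J x y \<Longrightarrow>
          \<phi> y \<ge> \<phi> x + \<phi>' x \<bullet> (y - x) + \<mu> / 2 * (norm (y - x))\<^sup>2"
    and alpha_pos: "0 < \<alpha>"
    and alpha_small: "\<alpha> * L < \<mu>"
begin

definition step :: "real^'n \<Rightarrow> real^'n" where
  "step = block_update J f' \<phi> \<phi>' \<alpha>"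

text \<open>One block update solves \<open>Psi 0 (step x) = Psi \<alpha> x\<close>: the optimality condition on the
  coordinates in \<open>J\<close>, completed by the identity on the others.\<close>

definition Psi :: "real \<Rightarrow> real^'n \<Rightarrow> real^'n" where
  "Psi \<beta> x = block_proj J (\<phi>' x) + (x - block_proj J x) + (- \<beta>) *\<^sub>R block_proj J (f' x)"

definition Psi' :: "real \<Rightarrow> real^'n \<Rightarrow> real^'n \<Rightarrow> real^'n" where
  "Psi' \<beta> a v = block_proj J (\<phi>'' a *v v) + (v - block_proj J v) + (- \<beta>) *\<^sub>R block_proj J (f'' a *v v)"

text \<open>\<open>\<phi>\<close> is invariant under translation by \<open>y - x\<close>, which
  vanishes on \<open>J\<close>, so uniqueness of the derivative identifies the two
  gradients.\<close>

lemma phi'_cong: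
  assumes "\<forall>i\<in>J. x $ i = y $ i"
  shows "\<phi>' x = \<phi>' y"
proof -
  have "((\<lambda>z. z + (y - x)) has_derivative (\<lambda>h. h)) (at x)"
    by (auto intro!: derivative_eq_intros)
  then have "((\<lambda>z. \<phi> (z + (y - x))) has_derivative (\<lambda>h. h \<bullet> \<phi>' y)) (at x)"
    using has_derivative_compose[of "\<lambda>z. z + (y - x)" "\<lambda>h. h" x UNIV \<phi> "\<lambda>h. h \<bullet> \<phi>' y"] phi_grad[of y]
    by simp
  moreover have "(\<lambda>z. \<phi> (z + (y - x))) = \<phi>"
    using assms by (auto simp: fun_eq_iff intro!: phi_block)
  ultimately have "(\<lambda>h. h \<bullet> \<phi>' y) = (\<lambda>h. h \<bullet> \<phi>' x)"
    using phi_grad[of x] has_derivative_unique by metis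
  then show ?thesis by (metis inner_commute vector_eq_ldot)
qed

text \<open>Sum of the strong convexity inequalities based at \<open>x\<close> and at
  \<open>y\<close>.\<close>

lemma phi'_strongly_monotone_block:
  assumes "same_off J x y"
  shows "(\<phi>' y - \<phi>' x) \<bullet> (y - x) \<ge> \<mu> * (norm (y - x))\<^sup>2"
proof -
  have "same_off J y x" using assms by (simp add: same_off_def)
  from strongly_convex[OF this] strongly_convex[OF assms] show ?thesis
    by (simp add: inner_diff_left inner_diff_right norm_minus_commute algebra_simps)
qed

lemma phi'_strongly_monotone:
  "(\<phi>' x - \<phi>' y) \<bullet> block_proj J (x - y) \<ge> \<mu> * (norm (block_proj J (x - y)))\<^sup>2"
proof -
  \<comment> \<open>\<open>z\<close> has the \<open>J\<close> coordinates of \<open>x\<close> and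
    differs from \<open>y\<close> only on the block, which reduces the claim to the block case for
    \<open>y\<close> and \<open>z\<close>.\<close>
  define z where "z = y + block_proj J (x - y)"
  have "\<phi>' z = \<phi>' x" by (rule phi'_cong) (simp add: z_def block_proj_nth)
  moreover have "same_off J y z" by (simp add: same_off_def z_def block_proj_nth)
  ultimately show ?thesis using phi'_strongly_monotone_block[of y z] by (simp add: z_def)
qed

lemma f''_bound: "norm (f'' x *v v) \<le> L * norm v"
proof -
  have "norm (f'' x *v v) \<le> onorm (\<lambda>h. f'' x *v h) * norm v"
    using linear_conv_bounded_linear by (intro onorm) auto
  also have "\<dots> \<le> L * norm v" by (intro mult_right_mono hess_bound) simp
  finally show ?thesis .
qed

lemma f'_Lipschitz: "norm (f' x - f' y) \<le> L * norm (x - y)"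
  using differentiable_bound[of UNIV f' "\<lambda>x h. f'' x *v h" L x y] f_hess hess_bound by auto

text \<open>Pair the difference \<open>D\<close> with the block part \<open>b\<close> of
  \<open>x - y\<close>: strong monotonicity yields \<open>\<mu> * (norm b)\<^sup>2\<close>, while
  the gradient term loses at most \<open>\<alpha> * L * norm (x - y) * norm b\<close>. The gap
  \<open>\<mu> - \<alpha> * L\<close> then bounds \<open>b\<close> by \<open>D\<close>.\<close>

lemma Psi_expanding:
  assumes beta: "0 \<le> \<beta>" "\<beta> \<le> \<alpha>"
  shows "norm (x - y) \<le> ((1 + \<alpha> * L) / (\<mu> - \<alpha> * L) + 1) * norm (Psi \<beta> x - Psi \<beta> y)"
proof -
  define v where "v = x - y"
  define b where "b = block_proj J v"
  define w where "w = v - b"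
  define D where "D = Psi \<beta> x - Psi \<beta> y"
  have D: "D = block_proj J (\<phi>' x - \<phi>' y) + w - \<beta> *\<^sub>R block_proj J (f' x - f' y)"
    by (simp add: D_def Psi_def w_def b_def v_def linear_diff[OF linear_block_proj] algebra_simps)
  \<comment> \<open>Off \<open>J\<close> the map \<open>Psi \<beta>\<close> is the identity, so the
    complementary part \<open>w\<close> is read off from \<open>D\<close>.\<close>
  have "w = D - block_proj J D"
    by (auto simp: D w_def b_def vec_eq_iff block_proj_nth)
  then have w: "norm w \<le> norm D" using norm_block_proj_compl_le by simp
  have vbw: "norm v \<le> norm b + norm w" using norm_triangle_ineq[of b w] by (simp add: w_def)
  have bb: "block_proj J b = b" by (simp add: b_def block_proj_idem)
  have wb: "w \<bullet> b = 0" using bb inner_block_proj_right[of w J b]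
    by (simp add: w_def b_def linear_diff[OF linear_block_proj] block_proj_idem)
  have pb: "block_proj J u \<bullet> b = u \<bullet> b" for u using inner_block_proj_right[of u J b] bb by simp
  have Db: "D \<bullet> b = (\<phi>' x - \<phi>' y) \<bullet> b - \<beta> * ((f' x - f' y) \<bullet> b)"
    by (simp add: D inner_add_left inner_diff_left[of _ "\<beta> *\<^sub>R _"] wb pb)
  have "\<beta> * ((f' x - f' y) \<bullet> b) \<le> \<alpha> * L * (norm v * norm b)"
  proof -
    have "(f' x - f' y) \<bullet> b \<le> norm (f' x - f' y) * norm b" by (rule norm_cauchy_schwarz)
    also have "\<dots> \<le> (L * norm v) * norm b" unfolding v_def by (intro mult_right_mono f'_Lipschitz) simp
    finally have "\<beta> * ((f' x - f' y) \<bullet> b) \<le> \<beta> * ((L * norm v) * norm b)"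
      using beta by (intro mult_left_mono)
    also have "\<dots> \<le> \<alpha> * ((L * norm v) * norm b)" using beta L_pos by (intro mult_right_mono) auto
    finally show ?thesis by (simp add: mult_ac)
  qed
  moreover have "(\<phi>' x - \<phi>' y) \<bullet> b \<ge> \<mu> * (norm b * norm b)"
    using phi'_strongly_monotone[of x y] by (simp add: b_def v_def power2_eq_square)
  moreover have "D \<bullet> b \<le> norm D * norm b" by (rule norm_cauchy_schwarz)
  ultimately have "(\<mu> * norm b) * norm b \<le> (norm D + \<alpha> * L * norm v) * norm b"
    using Db by (simp add: algebra_simps)
  then have "\<mu> * norm b \<le> norm D + \<alpha> * L * norm v"
  proof (cases "b = 0")
    case True then show ?thesis using alpha_pos L_pos by simp
  qed simp
  also have "\<dots> \<le> norm D + \<alpha> * L * (norm b + norm D)"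
    using alpha_pos L_pos vbw w by (intro add_left_mono mult_left_mono) auto
  finally have "(\<mu> - \<alpha> * L) * norm b \<le> (1 + \<alpha> * L) * norm D" by (simp add: algebra_simps)
  then have "norm b \<le> (1 + \<alpha> * L) / (\<mu> - \<alpha> * L) * norm D"
    using alpha_small by (simp add: field_simps)
  then show ?thesis using vbw w by (simp add: v_def D_def algebra_simps)
qed

lemma Psi_eq_iff: "0 \<le> \<beta> \<Longrightarrow> \<beta> \<le> \<alpha> \<Longrightarrow> Psi \<beta> x = Psi \<beta> y \<longleftrightarrow> x = y"
  using Psi_expanding[of \<beta> x y] by auto

text \<open>Ensures that the \<open>SOME\<close> in \<open>block_update\<close> picks a genuine
  minimizer. Strong convexity makes the objective coercive, so the minimum over a compact part of
  the slice is global there.\<close>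

lemma block_obj_attains_min:
  "\<exists>y. same_off J x y \<and>
     (\<forall>z. same_off J x z \<longrightarrow> block_obj J f' \<phi> \<phi>' \<alpha> x y \<le> block_obj J f' \<phi> \<phi>' \<alpha> x z)"
proof -
  define F where "F = block_obj J f' \<phi> \<phi>' \<alpha> x"
  \<comment> \<open>Beyond distance \<open>2 * \<alpha> * norm (f' x) / \<mu>\<close> from
    \<open>x\<close> the quadratic growth of the divergence outweighs the linear term, so no point
    outside the ball does better than \<open>x\<close>.\<close>
  define R where "R = 2 * \<alpha> * norm (f' x) / \<mu> + 1"
  have R: "R > 0" using alpha_pos mu_pos by (simp add: R_def add_nonneg_pos)
  define K where "K = {y. same_off J x y} \<inter> cball x R"
  have "{y. same_off J x y} = (\<Inter>i\<in>-J. {y. y $ i = x $ i})" by (auto simp: same_off_def)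
  then have "closed {y. same_off J x y}"
    by (auto intro!: closed_INT closed_Collect_eq continuous_intros)
  then have K: "compact K" unfolding K_def by (intro closed_Int_compact) auto
  have xK: "x \<in> K" using R by (simp add: K_def same_off_def)
  have "continuous_on UNIV \<phi>"
    using phi_grad by (meson differentiable_imp_continuous_on differentiable_def differentiable_on_def has_derivative_at_withinI)
  then have "continuous_on K F" unfolding F_def block_obj_def bregman_def
    by (intro continuous_intros) (auto intro: continuous_on_subset)
  then obtain y where y: "y \<in> K" "\<And>z. z \<in> K \<Longrightarrow> F y \<le> F z"
    using continuous_attains_inf[OF K, of F] xK by blast
  have "F y \<le> F z" if z: "same_off J x z" for z
  proof (cases "z \<in> K")
    case False
    then have far: "norm (z - x) > R" using z by (simp add: K_def dist_norm norm_minus_commute)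
    define d where "d = z - x"
    have d: "block_proj J d = d" using z by (simp add: d_def same_off_iff_block_proj)
    have "F z - F x = d \<bullet> f' x + (\<phi> z - \<phi> x - d \<bullet> \<phi>' x) / \<alpha>"
      using inner_block_proj[of J d "f' x"] d
      by (simp add: F_def block_obj_def bregman_def d_def left_diff_distrib sum_subtractf)
    moreover have "(\<phi> z - \<phi> x - d \<bullet> \<phi>' x) / \<alpha> \<ge> (\<mu> / 2 * (norm d)\<^sup>2) / \<alpha>"
      using strongly_convex[OF z] alpha_pos by (intro divide_right_mono) (auto simp: d_def inner_commute)
    moreover have "d \<bullet> f' x \<ge> - (norm d * norm (f' x))"
      using Cauchy_Schwarz_ineq2[of d "f' x"] by linarith
    moreover have "(\<mu> / 2 * (norm d)\<^sup>2) / \<alpha> \<ge> norm d * norm (f' x)"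
    proof -
      have "2 * \<alpha> * norm (f' x) / \<mu> \<le> norm d" using far by (simp add: R_def d_def)
      then have "2 * \<alpha> * norm (f' x) \<le> \<mu> * norm d" using mu_pos by (simp add: field_simps)
      then have "norm d * (2 * \<alpha> * norm (f' x)) \<le> norm d * (\<mu> * norm d)" by (intro mult_left_mono) auto
      then show ?thesis using alpha_pos by (simp add: field_simps power2_eq_square)
    qed
    ultimately have "F x \<le> F z" by linarith
    then show ?thesis using y(2)[OF xK] by linarith
  qed (use y in auto)
  then show ?thesis using y(1) unfolding K_def F_def by blast
qed

lemma step_properties:
  shows same_off_step: "same_off J x (step x)"
    and step_min: "same_off J x z \<Longrightarrow> block_obj J f' \<phi> \<phi>' \<alpha> x (step x) \<le> block_obj J f' \<phi> \<phi>' \<alpha> x z"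
  using someI_ex[OF block_obj_attains_min[of x]] unfolding step_def block_update_def by auto

text \<open>Fermat's rule on the line through the minimizer in direction \<open>axis i 1\<close>,
  which stays in the admissible slice because \<open>i \<in> J\<close>.\<close>

lemma step_first_order:
  assumes i: "i \<in> J"
  shows "\<phi>' (step x) $ i = \<phi>' x $ i - \<alpha> * f' x $ i"
proof -
  define y where "y = step x"
  define F where "F z = (\<Sum>j\<in>J. z $ j * f' x $ j) + (1 / \<alpha>) * (\<phi> z - \<phi> x - (z - x) \<bullet> \<phi>' x)" for z
  have F: "F = block_obj J f' \<phi> \<phi>' \<alpha> x" by (simp add: fun_eq_iff F_def block_obj_def bregman_def)
  define q where "q t = F (y + t *\<^sub>R axis i 1)" for t :: real
  have Feq: "F z = block_proj J (f' x) \<bullet> z + (1 / \<alpha>) * (\<phi> z - \<phi> x - (z - x) \<bullet> \<phi>' x)" for z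
    by (simp add: F_def inner_block_proj mult.commute)
  have DF: "(F has_derivative (\<lambda>h. block_proj J (f' x) \<bullet> h + (1 / \<alpha>) * (h \<bullet> \<phi>' y - h \<bullet> \<phi>' x))) (at y)"
    unfolding Feq[abs_def] using alpha_pos by (auto intro!: derivative_eq_intros phi_grad simp: fun_eq_iff)
  have "(q has_derivative (\<lambda>t. block_proj J (f' x) \<bullet> (t *\<^sub>R axis i 1)
      + (1 / \<alpha>) * ((t *\<^sub>R axis i 1) \<bullet> \<phi>' y - (t *\<^sub>R axis i 1) \<bullet> \<phi>' x))) (at 0)"
    unfolding q_def
    by (rule has_derivative_compose[where g = F and f = "\<lambda>t. y + t *\<^sub>R axis i 1"])
      (use DF in \<open>auto intro!: derivative_eq_intros\<close>)
  moreover have "q 0 \<le> q t" for t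
    using step_min[of x "y + t *\<^sub>R axis i 1"] same_off_step[of x] i
    by (auto simp: q_def F y_def same_off_def axis_def)
  ultimately have "(\<lambda>t. block_proj J (f' x) \<bullet> (t *\<^sub>R axis i 1)
      + (1 / \<alpha>) * ((t *\<^sub>R axis i 1) \<bullet> \<phi>' y - (t *\<^sub>R axis i 1) \<bullet> \<phi>' x)) = (\<lambda>t. 0)"
    by (intro has_derivative_local_min[where f = q]) auto
  from fun_cong[OF this, of 1] show ?thesis
    using i alpha_pos by (simp add: inner_axis inner_axis' block_proj_nth y_def field_simps)
qed

lemma Psi_step: "Psi 0 (step x) = Psi \<alpha> x"
proof (subst vec_eq_iff, rule allI)
  fix i show "Psi 0 (step x) $ i = Psi \<alpha> x $ i"
    using same_off_step[of x] step_first_order[of i x]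
    by (cases "i \<in> J") (simp_all add: Psi_def block_proj_nth same_off_def)
qed

text \<open>\<open>Psi \<alpha>\<close> maps the preimage of \<open>N\<close> into the image of
  \<open>N\<close> under the differentiable map \<open>Psi 0\<close>, which is null; expansion of
  \<open>Psi \<alpha>\<close> carries this back to the preimage.\<close>

lemma negligible_step_preimage:
  assumes "negligible N"
  shows "negligible {x. step x \<in> N}"
proof -
  have lin: "(block_proj J has_derivative block_proj J) (at x)" for x
    using linear_block_proj linear_conv_bounded_linear bounded_linear_imp_has_derivative by blast
  have "(Psi 0 has_derivative (\<lambda>h. block_proj J (\<phi>'' x *v h) + (h - block_proj J h))) (at x)" for x
    unfolding Psi_def[abs_def]
    by (auto intro!: derivative_eq_intros has_derivative_compose[OF phi_hess lin] lin)
  then have "Psi 0 differentiable_on N"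
    by (meson differentiable_def differentiable_on_def has_derivative_at_withinI)
  then have "negligible (Psi 0 ` N)"
    using assms by (intro negligible_differentiable_image_negligible) auto
  moreover have "Psi \<alpha> ` {x. step x \<in> N} \<subseteq> Psi 0 ` N"
    by (auto simp flip: Psi_step)
  ultimately have "negligible (Psi \<alpha> ` {x. step x \<in> N})" by (rule negligible_subset)
  then show ?thesis
    by (rule negligible_of_negligible_expanding_image[OF _ Psi_expanding]) (use alpha_pos in auto)
qed

section \<open>Linearization of a block update at a critical point\<close>

lemma step_fixpoint:
  assumes "f' a = 0"
  shows "step a = a"
proof -
  have "Psi \<alpha> a = Psi 0 a" using assms by (simp add: Psi_def linear_0[OF linear_block_proj])
  then show ?thesis using Psi_step[of a] Psi_eq_iff[of 0] alpha_pos by simp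
qed

lemma Psi_has_strict_derivative: "has_strict_derivative (Psi \<beta>) (Psi' \<beta> a) a"
proof -
  have P: "has_strict_derivative (\<lambda>x. block_proj J (F x)) (\<lambda>x. block_proj J (A x)) a"
    if "has_strict_derivative F A a" for F A
    using that by (rule has_strict_derivative_compose)
      (rule has_strict_derivative_linear[OF linear_block_proj])
  have C: "has_strict_derivative (\<lambda>x. (-\<beta>) *\<^sub>R F x) (\<lambda>x. (-\<beta>) *\<^sub>R A x) a"
    if "has_strict_derivative F A a" for F A :: "real^'n \<Rightarrow> real^'n"
    using that by (rule has_strict_derivative_compose)
      (rule has_strict_derivative_linear[OF linear_scale_self])
  have "linear (\<lambda>x. x - block_proj J x)"
    by (intro linear_compose_sub linear_ident linear_block_proj)
  then show ?thesis unfolding Psi_def[abs_def] Psi'_def[abs_def]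
    by (intro has_strict_derivative_add P C has_strict_derivative_linear
        has_strict_derivative_C1[OF phi_hess phi_C2] has_strict_derivative_C1[OF f_hess f_C2])
qed

text \<open>Infinitesimal strong monotonicity: compare \<open>a + t *\<^sub>R v\<close> with
  \<open>a\<close>, replace the gradient difference by \<open>t *\<^sub>R (\<phi>'' a *v v)\<close>
  up to a small error, and cancel \<open>t\<close> twice.\<close>

lemma phi''_coercive:
  assumes v: "block_proj J v = v"
  shows "\<mu> * (norm v)\<^sup>2 \<le> v \<bullet> (\<phi>'' a *v v)"
proof (rule field_le_epsilon)
  fix e :: real assume e: "e > 0"
  define \<epsilon> where "\<epsilon> = e / ((norm v)\<^sup>2 + 1)"
  have pos: "(norm v)\<^sup>2 + 1 > 0" by (simp add: add_nonneg_pos)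
  have eps: "\<epsilon> > 0" using e pos by (simp add: \<epsilon>_def)
  have le: "\<epsilon> * (norm v)\<^sup>2 \<le> e" using e pos by (simp add: \<epsilon>_def field_simps)
  obtain \<delta> where d: "\<delta> > 0" "\<And>x y. x \<in> ball a \<delta> \<Longrightarrow> y \<in> ball a \<delta> \<Longrightarrow>
      norm (\<phi>' x - \<phi>' y - \<phi>'' a *v (x - y)) \<le> \<epsilon> * norm (x - y)"
    using has_strict_derivativeD[OF has_strict_derivative_C1[OF phi_hess phi_C2] eps] by metis
  define t where "t = \<delta> / (norm v + 1)"
  have pos': "norm v + 1 > 0" by (simp add: add_nonneg_pos)
  have t: "t > 0" using d pos' by (simp add: t_def)
  have "t * (norm v + 1) = \<delta>" using pos' by (simp add: t_def)
  then have "t * norm v < \<delta>" using t by (simp add: algebra_simps)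
  then have "a + t *\<^sub>R v \<in> ball a \<delta>" "a \<in> ball a \<delta>" using t d by (auto simp: dist_norm)
  from d(2)[OF this] have "norm (\<phi>' (a + t *\<^sub>R v) - \<phi>' a - t *\<^sub>R (\<phi>'' a *v v)) \<le> \<epsilon> * (t * norm v)"
    using t by (simp add: matrix_vector_mult_scaleR)
  then have "norm v * norm (\<phi>' (a + t *\<^sub>R v) - \<phi>' a - t *\<^sub>R (\<phi>'' a *v v)) \<le> norm v * (\<epsilon> * (t * norm v))"
    by (intro mult_left_mono) auto
  then have "v \<bullet> (\<phi>' (a + t *\<^sub>R v) - \<phi>' a - t *\<^sub>R (\<phi>'' a *v v)) \<le> t * (\<epsilon> * (norm v)\<^sup>2)"
    using norm_cauchy_schwarz[of v "\<phi>' (a + t *\<^sub>R v) - \<phi>' a - t *\<^sub>R (\<phi>'' a *v v)"]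
    by (simp add: power2_eq_square mult_ac)
  then have 1: "v \<bullet> (\<phi>' (a + t *\<^sub>R v) - \<phi>' a) \<le> t * (v \<bullet> (\<phi>'' a *v v) + \<epsilon> * (norm v)\<^sup>2)"
    by (simp add: inner_diff_right algebra_simps)
  have "same_off J a (a + t *\<^sub>R v)"
    using v by (simp add: same_off_iff_block_proj linear_scale[OF linear_block_proj])
  from phi'_strongly_monotone_block[OF this]
  have "t * (t * (\<mu> * (norm v)\<^sup>2)) \<le> t * (v \<bullet> (\<phi>' (a + t *\<^sub>R v) - \<phi>' a))"
    by (simp add: inner_commute power_mult_distrib power2_eq_square mult_ac)
  then have "t * (\<mu> * (norm v)\<^sup>2) \<le> v \<bullet> (\<phi>' (a + t *\<^sub>R v) - \<phi>' a)" using t by simp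
  with 1 have "\<mu> * (norm v)\<^sup>2 \<le> v \<bullet> (\<phi>'' a *v v) + \<epsilon> * (norm v)\<^sup>2"
    using t by (meson mult_le_cancel_left_pos order_trans)
  then show "\<mu> * (norm v)\<^sup>2 \<le> v \<bullet> (\<phi>'' a *v v) + e" using le by simp
qed

text \<open>A kernel vector vanishes off \<open>J\<close>, where \<open>Psi' 0 a\<close> acts as the
  identity, and coercivity of \<open>\<phi>'' a\<close> on block vectors leaves only zero.\<close>

lemma inj_Psi'_0: "inj (Psi' 0 a)"
proof -
  have lin: "linear (Psi' 0 a)"
    using Psi_has_strict_derivative by (simp add: has_strict_derivative_def)
  have "v = 0" if z: "Psi' 0 a v = 0" for v
  proof -
    have v: "block_proj J v = v" using z
      by (auto simp: Psi'_def vec_eq_iff block_proj_nth split: if_splits)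
    then have "block_proj J (\<phi>'' a *v v) = 0" using z by (simp add: Psi'_def)
    then have "v \<bullet> (\<phi>'' a *v v) = 0" using inner_block_proj_right[of v J "\<phi>'' a *v v"] v by simp
    then show ?thesis using phi''_coercive[OF v, of a] mu_pos by (simp add: mult_le_0_iff)
  qed
  then show ?thesis by (simp add: linear_injective_0[OF lin])
qed

text \<open>Linearizing \<open>Psi 0 (step x) = Psi \<alpha> x\<close> shows that
  \<open>d = A v - v\<close> is a block vector with \<open>\<phi>'' a *v d\<close> equal to
  \<open>- \<alpha> *\<^sub>R (f'' a *v v)\<close> on \<open>J\<close>: a preconditioned gradient
  step for the Hessian form, whose descent is the inequality.\<close>

lemma step_linearization:
  assumes crit: "f' a = 0" and sym: "\<And>x y. x \<bullet> (f'' a *v y) = (f'' a *v x) \<bullet> y"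
  obtains A c where "has_strict_derivative step A a" "c > 0"
    "\<And>v. A v \<bullet> (f'' a *v A v) \<le> v \<bullet> (f'' a *v v) - c * (norm (A v - v))\<^sup>2"
    "\<And>v i. A v = v \<Longrightarrow> i \<in> J \<Longrightarrow> (f'' a *v v) $ i = 0"
    "\<And>v. f'' a *v v = 0 \<Longrightarrow> A v = v"
proof -
  have lin: "linear (Psi' 0 a)"
    using Psi_has_strict_derivative by (simp add: has_strict_derivative_def)
  obtain Mi where Mi: "linear Mi" "\<And>x. Mi (Psi' 0 a x) = x" "\<And>x. Psi' 0 a (Mi x) = x"
    using linear_injective_isomorphism[OF lin inj_Psi'_0] by metis
  define A where "A v = Mi (Psi' \<alpha> a v)" for v
  have A: "Psi' 0 a (A v) = Psi' \<alpha> a v" for v by (simp add: A_def Mi)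
  have off: "block_proj J (A v - v) = A v - v" for v
    using A[of v] by (auto simp: Psi'_def vec_eq_iff block_proj_nth split: if_splits)
  have on: "block_proj J (\<phi>'' a *v (A v - v)) = - \<alpha> *\<^sub>R block_proj J (f'' a *v v)" for v
  proof -
    have "block_proj J (\<phi>'' a *v A v) - block_proj J (\<phi>'' a *v v)
        = (block_proj J (A v - v) - (A v - v)) - \<alpha> *\<^sub>R block_proj J (f'' a *v v)"
      using A[of v] by (simp add: Psi'_def linear_diff[OF linear_block_proj] algebra_simps)
    then show ?thesis
      unfolding off by (simp add: matrix_vector_mult_diff_distrib linear_diff[OF linear_block_proj])
  qed
  show ?thesis
  \<comment> \<open>The form changes by
    \<open>2 * (d \<bullet> (f'' a *v v)) + d \<bullet> (f'' a *v d)\<close>. Here coercivity gives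
    \<open>d \<bullet> (f'' a *v v) \<le> - (\<mu> / \<alpha>) * (norm d)\<^sup>2\<close>, and the
    last term is at most \<open>L * (norm d)\<^sup>2\<close>.\<close>
  proof (rule that[of A "2 * \<mu> / \<alpha> - L"])
    show "has_strict_derivative step A a"
      unfolding A_def[abs_def]
      by (rule has_strict_derivative_implicit[OF Psi_has_strict_derivative Psi_has_strict_derivative
            Psi_step step_fixpoint[OF crit] Psi_expanding Mi(1,2)]) (use alpha_pos in auto)
    have "L < 2 * \<mu> / \<alpha>" using alpha_small alpha_pos mu_pos by (simp add: field_simps)
    then show "2 * \<mu> / \<alpha> - L > 0" by simp
    fix v
    define d where "d = A v - v"
    have d: "block_proj J d = d" using off by (simp add: d_def)
    have "d \<bullet> (\<phi>'' a *v d) = d \<bullet> block_proj J (\<phi>'' a *v d)" using inner_block_proj_right[of d] d by simp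
    also have "\<dots> = - \<alpha> * (d \<bullet> (f'' a *v v))"
      using on[of v] inner_block_proj_right[of d] d by (simp add: d_def)
    finally have "d \<bullet> (f'' a *v v) = - (d \<bullet> (\<phi>'' a *v d)) / \<alpha>" using alpha_pos by (simp add: field_simps)
    also have "\<dots> \<le> - (\<mu> * (norm d)\<^sup>2) / \<alpha>"
      using phi''_coercive[OF d, of a] alpha_pos by (intro divide_right_mono) auto
    finally have 1: "d \<bullet> (f'' a *v v) \<le> - (\<mu> * (norm d)\<^sup>2) / \<alpha>" .
    have "d \<bullet> (f'' a *v d) \<le> norm d * norm (f'' a *v d)" by (rule norm_cauchy_schwarz)
    also have "\<dots> \<le> norm d * (L * norm d)" by (intro mult_left_mono f''_bound) simp
    finally have 2: "d \<bullet> (f'' a *v d) \<le> L * (norm d)\<^sup>2" by (simp add: power2_eq_square mult_ac)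
    have "A v = v + d" by (simp add: d_def)
    then have "A v \<bullet> (f'' a *v A v) = v \<bullet> (f'' a *v v) + 2 * (d \<bullet> (f'' a *v v)) + d \<bullet> (f'' a *v d)"
      using sym[of v d]
      by (simp add: matrix_vector_right_distrib inner_add_left inner_add_right inner_commute)
    then show "A v \<bullet> (f'' a *v A v) \<le> v \<bullet> (f'' a *v v) - (2 * \<mu> / \<alpha> - L) * (norm (A v - v))\<^sup>2"
      using 1 2 by (simp add: d_def[symmetric] algebra_simps)
  next
    fix v i assume "A v = v" "i \<in> J"
    then have "block_proj J (f'' a *v v) = 0"
      using on[of v] alpha_pos by (simp add: linear_0[OF linear_block_proj])
    then show "(f'' a *v v) $ i = 0"
      using \<open>i \<in> J\<close> block_proj_nth[of J "f'' a *v v" i] by simp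
  next
    fix v assume "f'' a *v v = 0"
    then have "Psi' \<alpha> a v = Psi' 0 a v" by (simp add: Psi'_def linear_0[OF linear_block_proj])
    then show "A v = v" by (simp add: A_def Mi)
  qed
qed

end

section \<open>The full sweep\<close>

text \<open>Induction over the blocks. The descents of successive updates add up, and a vector fixed
  by the composite has total descent zero, hence is fixed by each update; so the vanishing of
  \<open>H *v v\<close> is collected block by block.\<close>

lemma bmd_inner_linearization:
  fixes I :: "nat \<Rightarrow> 'n::finite set" and H :: "real^'n^'n"
  assumes bs: "\<And>s. s < p \<Longrightarrow> block_step (I s) f' f'' (\<phi> s) (\<phi>' s) (\<phi>'' s) (\<mu> s) L \<alpha>"
    and crit: "f' a = 0" and H: "H = f'' a" and sym: "\<And>x y. x \<bullet> (H *v y) = (H *v x) \<bullet> y"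
    and s: "s \<le> p"
  shows "bmd_inner I f' \<phi> \<phi>' \<alpha> a s = a \<and>
    (\<exists>T c. has_strict_derivative (\<lambda>x. bmd_inner I f' \<phi> \<phi>' \<alpha> x s) T a \<and> c > 0 \<and>
      (\<forall>v. T v \<bullet> (H *v T v) \<le> v \<bullet> (H *v v) - c * (norm (T v - v))\<^sup>2) \<and>
      (\<forall>v. T v = v \<longrightarrow> (\<forall>r<s. \<forall>i\<in>I r. (H *v v) $ i = 0)) \<and>
      (\<forall>v. H *v v = 0 \<longrightarrow> T v = v))"
  using s
proof (induction s)
  case 0
  \<comment> \<open>The empty sweep is the identity with zero displacement, so any positive constant
    serves.\<close>
  show ?case
    by (auto intro!: exI[of _ "\<lambda>x. x"] exI[of _ 1] has_strict_derivative_id)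
next
  case (Suc s)
  let ?G = "\<lambda>x. bmd_inner I f' \<phi> \<phi>' \<alpha> x s"
  interpret block_step "I s" f' f'' "\<phi> s" "\<phi>' s" "\<phi>'' s" "\<mu> s" L \<alpha>
    using bs Suc.prems by simp
  from Suc obtain T c where G: "?G a = a" and T: "has_strict_derivative ?G T a" "c > 0"
    "\<And>v. T v \<bullet> (H *v T v) \<le> v \<bullet> (H *v v) - c * (norm (T v - v))\<^sup>2"
    "\<And>v r i. T v = v \<Longrightarrow> r < s \<Longrightarrow> i \<in> I r \<Longrightarrow> (H *v v) $ i = 0"
    "\<And>v. H *v v = 0 \<Longrightarrow> T v = v"
    by auto
  obtain A d where A: "has_strict_derivative step A a" "d > 0"
    "\<And>v. A v \<bullet> (H *v A v) \<le> v \<bullet> (H *v v) - d * (norm (A v - v))\<^sup>2"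
    "\<And>v i. A v = v \<Longrightarrow> i \<in> I s \<Longrightarrow> (H *v v) $ i = 0"
    "\<And>v. H *v v = 0 \<Longrightarrow> A v = v"
    using step_linearization[OF crit sym[unfolded H], folded H] by metis
  have eq: "bmd_inner I f' \<phi> \<phi>' \<alpha> x (Suc s) = step (?G x)" for x by (simp add: step_def)
  have dec: "A (T v) \<bullet> (H *v A (T v))
      \<le> v \<bullet> (H *v v) - c * (norm (T v - v))\<^sup>2 - d * (norm (A (T v) - T v))\<^sup>2" for v
    using A(3)[of "T v"] T(3)[of v] by linarith
  \<comment> \<open>The half pays for
    \<open>(x + y)\<^sup>2 \<le> 2 * (x\<^sup>2 + y\<^sup>2)\<close>, which bounds the total
    displacement by those of the two maps.\<close>
  define e where "e = min c d / 2"
  have "A (T v) \<bullet> (H *v A (T v)) \<le> v \<bullet> (H *v v) - e * (norm (A (T v) - v))\<^sup>2" for v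
  proof -
    define x y where "x = norm (T v - v)" and "y = norm (A (T v) - T v)"
    have "norm (A (T v) - v) \<le> x + y"
      using norm_triangle_ineq[of "T v - v" "A (T v) - T v"] by (simp add: x_def y_def)
    then have "(norm (A (T v) - v))\<^sup>2 \<le> (x + y)\<^sup>2" by (intro power_mono) auto
    also have "\<dots> \<le> 2 * (x\<^sup>2 + y\<^sup>2)"
      using zero_le_power2[of "x - y"] by (simp add: power2_sum power2_diff)
    finally have "e * (norm (A (T v) - v))\<^sup>2 \<le> e * (2 * (x\<^sup>2 + y\<^sup>2))"
      using T(2) A(2) by (intro mult_left_mono) (auto simp: e_def)
    also have "\<dots> = min c d * x\<^sup>2 + min c d * y\<^sup>2" by (simp add: e_def algebra_simps)
    also have "\<dots> \<le> c * x\<^sup>2 + d * y\<^sup>2" by (intro add_mono mult_right_mono) auto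
    finally show ?thesis using dec[of v] by (simp add: x_def y_def)
  qed
  \<comment> \<open>With equal values of the form at both ends, \<open>dec\<close> forces both
    displacements to vanish, so the two maps cannot undo each other.\<close>
  moreover have "T v = v \<and> A v = v" if fixed: "A (T v) = v" for v
  proof -
    have "c * (norm (T v - v))\<^sup>2 + d * (norm (A (T v) - T v))\<^sup>2 \<le> 0" using dec[of v] fixed by simp
    moreover have "c * (norm (T v - v))\<^sup>2 \<ge> 0" "d * (norm (A (T v) - T v))\<^sup>2 \<ge> 0"
      using T(2) A(2) by auto
    ultimately have "c * (norm (T v - v))\<^sup>2 = 0" by linarith
    then have "T v = v" using T(2) by simp
    then show ?thesis using fixed by simp
  qed
  moreover have "has_strict_derivative (\<lambda>x. step (?G x)) (\<lambda>v. A (T v)) a"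
    by (rule has_strict_derivative_compose[OF T(1)]) (simp add: G A(1))
  moreover have "e > 0" using T(2) A(2) by (simp add: e_def)
  moreover have "\<forall>v. H *v v = 0 \<longrightarrow> A (T v) = v" using T(5) A(5) by simp
  moreover have "step (?G a) = a" using G step_fixpoint[OF crit] by simp
  moreover have "(H *v v) $ i = 0" if "T v = v \<and> A v = v" "r < Suc s" "i \<in> I r" for v r i
    using that T(4) A(4) by (auto simp: less_Suc_eq)
  ultimately show ?case unfolding eq by blast
qed

lemma negligible_bmd_inner_preimage:
  fixes I :: "nat \<Rightarrow> 'n::finite set"
  assumes bs: "\<And>s. s < p \<Longrightarrow> block_step (I s) f' f'' (\<phi> s) (\<phi>' s) (\<phi>'' s) (\<mu> s) L \<alpha>"
    and s: "s \<le> p" and N: "negligible N"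
  shows "negligible {x. bmd_inner I f' \<phi> \<phi>' \<alpha> x s \<in> N}"
  using s N
proof (induction s arbitrary: N)
  case (Suc s)
  interpret block_step "I s" f' f'' "\<phi> s" "\<phi>' s" "\<phi>'' s" "\<mu> s" L \<alpha>
    using bs Suc.prems by simp
  \<comment> \<open>The last block is pulled back first, so the induction hypothesis is applied to
    the null set \<open>{x. step x \<in> N}\<close>.\<close>
  show ?case
    using Suc.IH[OF _ negligible_step_preimage[OF Suc.prems(2)]] Suc.prems(1)
    by (simp add: step_def)
qed simp

theorem theorem5:
  fixes f :: "real^'n \<Rightarrow> real" and f' :: "real^'n \<Rightarrow> real^'n" and f'' :: "real^'n \<Rightarrow> real^'n^'n"
    and p :: nat and I :: "nat \<Rightarrow> 'n set"
    and \<phi> :: "nat \<Rightarrow> real^'n \<Rightarrow> real" and \<phi>' :: "nat \<Rightarrow> real^'n \<Rightarrow> real^'n"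
    and \<phi>'' :: "nat \<Rightarrow> real^'n \<Rightarrow> real^'n^'n"
    and \<mu>t :: "nat \<Rightarrow> real" and L \<alpha> :: real
  assumes blocks: "block_partition p I"
    and f_grad: "\<And>x. (f has_derivative (\<lambda>h. h \<bullet> f' x)) (at x)"
    and f_hess: "\<And>x. (f' has_derivative (\<lambda>h. f'' x *v h)) (at x)"
    and f_C2: "continuous_on UNIV f''"
    and hess_bound: "\<And>x. onorm (\<lambda>h. f'' x *v h) \<le> L"
    and L_pos: "L > 0"
    and phi_block: "\<And>t x y. t < p \<Longrightarrow> (\<forall>i\<in>I t. x $ i = y $ i) \<Longrightarrow> \<phi> t x = \<phi> t y"
    and phi_grad: "\<And>t x. t < p \<Longrightarrow> (\<phi> t has_derivative (\<lambda>h. h \<bullet> \<phi>' t x)) (at x)"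
    and phi_hess: "\<And>t x. t < p \<Longrightarrow> (\<phi>' t has_derivative (\<lambda>h. \<phi>'' t x *v h)) (at x)"
    and phi_C2: "\<And>t. t < p \<Longrightarrow> continuous_on UNIV (\<phi>'' t)"
    and mu_pos: "\<And>t. t < p \<Longrightarrow> \<mu>t t > 0"
    and strongly_convex: "\<And>t x y. t < p \<Longrightarrow> same_off (I t) x y \<Longrightarrow>
          \<phi> t y \<ge> \<phi> t x + \<phi>' t x \<bullet> (y - x) + \<mu>t t / 2 * (norm (y - x))\<^sup>2"
    and alpha_pos: "0 < \<alpha>"
    and alpha_small: "\<alpha> < Min (\<mu>t ` {0..<p}) / L"
  shows "negligible {x0. \<exists>xs. strict_saddle f' f'' xs \<and>
                            bmd_seq p I f' \<phi> \<phi>' \<alpha> x0 \<longlonglongrightarrow> xs}"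
proof -
  \<comment> \<open>Bounding the minimum by each \<open>\<mu>t t\<close> gives every block its own
    step size condition.\<close>
  have "\<alpha> * L < \<mu>t t" if "t < p" for t
  proof -
    have "\<alpha> * L < Min (\<mu>t ` {0..<p})" using alpha_small L_pos by (simp add: field_simps)
    also have "\<dots> \<le> \<mu>t t" using that by (intro Min_le) auto
    finally show ?thesis .
  qed
  then have bs: "block_step (I t) f' f'' (\<phi> t) (\<phi>' t) (\<phi>'' t) (\<mu>t t) L \<alpha>" if "t < p" for t
    unfolding block_step_def using assms that by simp
  define g where "g = bmd_step p I f' \<phi> \<phi>' \<alpha>"
  have local: "\<exists>\<delta>>0. negligible {x. \<forall>k. (g ^^ k) x \<in> ball a \<delta>}" if a: "strict_saddle f' f'' a" for a
  proof -
    have crit: "f' a = 0" and neg: "lambda_min (f'' a) < 0" using a by (auto simp: strict_saddle_def)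
    have sym: "x \<bullet> (f'' a *v y) = (f'' a *v x) \<bullet> y" for x y
      using strict_derivative_of_gradient_selfadjoint[OF f_grad has_strict_derivative_C1[OF f_hess f_C2]] .
    obtain w where w: "w \<bullet> (f'' a *v w) < 0"
      using lambda_min_neg_imp_negative_direction[OF sym neg] .
    obtain T c where T: "has_strict_derivative g T a" "c > 0"
      "\<And>v. T v \<bullet> (f'' a *v T v) \<le> v \<bullet> (f'' a *v v) - c * (norm (T v - v))\<^sup>2"
      and fixed: "\<And>v r i. T v = v \<Longrightarrow> r < p \<Longrightarrow> i \<in> I r \<Longrightarrow> (f'' a *v v) $ i = 0"
      "\<And>v. f'' a *v v = 0 \<Longrightarrow> T v = v"
      using bmd_inner_linearization[where p = p and I = I and \<phi> = \<phi> and \<phi>' = \<phi>' and \<phi>'' = \<phi>'' and \<mu> = \<mu>t,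
        OF bs crit refl sym order_refl]
      unfolding g_def bmd_step_def[abs_def] by auto
    \<comment> \<open>The blocks cover all coordinates, so the blockwise conditions on a fixed
      vector of \<open>T\<close> amount to \<open>f'' a *v v = 0\<close>.\<close>
    have ker: "T v = v \<longleftrightarrow> f'' a *v v = 0" for v
    proof
      assume v: "T v = v"
      have "(f'' a *v v) $ i = 0" for i
      proof -
        have "i \<in> (\<Union>t<p. I t)" using blocks by (simp add: block_partition_def)
        then show ?thesis using fixed(1)[OF v] by blast
      qed
      then show "f'' a *v v = 0" by (simp add: vec_eq_iff)
    qed (rule fixed)
    have linT: "linear T" using T(1) by (simp add: has_strict_derivative_def)
    obtain B \<kappa> e where "linear B" "\<kappa> > 0" "e \<bullet> B e > 0"
      "\<And>v. v \<bullet> B v \<ge> 0 \<Longrightarrow> T v \<bullet> B (T v) \<ge> v \<bullet> B v + \<kappa> * (norm v)\<^sup>2"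
      \<comment> \<open>The direction \<open>w\<close> of negative curvature makes the expanding
        cone nontrivial.\<close>
      using expanding_cone[OF matrix_vector_mul_linear linT sym ker T(2,3) w] by metis
    from negligible_trapped_near_unstable_fixpoint[OF T(1) this] show ?thesis by metis
  qed
  have "negligible {x. g x \<in> N}" if "negligible N" for N
    using negligible_bmd_inner_preimage[where p = p and I = I and \<phi> = \<phi> and \<phi>' = \<phi>' and \<phi>'' = \<phi>'' and \<mu> = \<mu>t,
        OF bs order_refl that] by (simp add: g_def bmd_step_def)
  then have "negligible {x. \<exists>a\<in>{a. strict_saddle f' f'' a}. (\<lambda>k. (g ^^ k) x) \<longlonglongrightarrow> a}"
    using local by (intro negligible_convergent_to_locally_unstable_points) auto
  moreover have "bmd_seq p I f' \<phi> \<phi>' \<alpha> x = (\<lambda>k. (g ^^ k) x)" for x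
    by (simp add: fun_eq_iff bmd_seq_def g_def)
  ultimately show ?thesis by simp
qed

end
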